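(* Let $\mathcal{G}$ be a class of graphs with polynomial expansion. Let $\pi$ be a property of pairs $(G,Z)$ (with $G$ a graph and $Z\subseteq V(G)$ non-empty) of finite diameter, and let $\varepsilon>0$. Then there exists a positive integer $c$ such that for every graph $G\in\mathcal{G}$: every $\pi$-packing returned by the maximization $c$-local search on $G$ has size at least $(1-\varepsilon)\alpha_\pi(G)$, and every induced $\pi$-packing returned by the induced maximization $c$-local search on $G$ has size at least $(1-\varepsilon)\alpha'_\pi(G)$.
   Context: All graphs are finite and simple. A graph $H$ is an $r$-shallow minor of $G$ if a graph isomorphic to $H$ is obtained from a subgraph of $G$ by contracting pairwise vertex-disjoint subgraphs, each of radius at most $r$. The density of $H$ is $|E(H)|/|V(H)|$. A graph $G$ has expansion bounded by $f:\mathbb{Z}_0^+\to\mathbb{R}_0^+$ if for every non-negative integer $r$, every $r$-shallow minor of $G$ has density at most $f(r)$; a class has polynomial expansion if all its graphs have expansion bounded by some fixed polynomial $f$. A property $\pi$ is a property of pairs $(G,Z)$ where $G$ is a graph and $Z\subseteq V(G)$ is non-empty. The diameter of $\pi$ is the maximum diameter of $G[Z]$ over all pairs $(G,Z)$ satisfying $\pi$, or $\infty$ if these diameters are unbounded (in particular if $G[Z]$ is disconnected for some such pair). A $\pi$-packing in $G$ is a set $\mathcal{P}$ of pairwise disjoint subsets of $V(G)$ such that $(G,P)$ satisfies $\pi$ for every $P\in\mathcal{P}$; it is an induced $\pi$-packing if moreover no edge of $G$ has its ends in distinct elements of $\mathcal{P}$. $\alpha_\pi(G)$ and $\alpha'_\pi(G)$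 denote the maximum sizes of a $\pi$-packing and of an induced $\pi$-packing in $G$, respectively. The (induced) maximization $c$-local search on $G$: (1) set $\mathcal{P}=\emptyset$; (2) iterate over all $Y\subseteq\mathcal{P}$ with $|Y|<c$; if there is an (induced) $\pi$-packing $\mathcal{P}'\supseteq\mathcal{P}\setminus Y$ with $|\mathcal{P}'|>|\mathcal{P}|$, replace $\mathcal{P}$ by such $\mathcal{P}'$ and restart step (2). When no such $Y$ exists, return $\mathcal{P}$. *)

theory Defs
  imports Main "HOL-Computational_Algebra.Polynomial"
begin

type_synonym 'a graph = "'a set \<times> 'a set set"

definition verts :: "'a graph \<Rightarrow> 'a set" where
  "verts G = fst G"

definition edges :: "'a graph \<Rightarrow> 'a set set" where
  "edges G = snd G"

definition simple_graph :: "'a graph \<Rightarrow> bool" where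
  "simple_graph G \<longleftrightarrow> finite (verts G) \<and>
     (\<forall>e\<in>edges G. \<exists>u v. u \<noteq> v \<and> e = {u, v} \<and> u \<in> verts G \<and> v \<in> verts G)"

definition induced :: "'a graph \<Rightarrow> 'a set \<Rightarrow> 'a graph" where
  "induced G Z = (Z, {e \<in> edges G. e \<subseteq> Z})"

definition adj :: "'a graph \<Rightarrow> 'a \<Rightarrow> 'a \<Rightarrow> bool" where
  "adj G u v \<longleftrightarrow> u \<noteq> v \<and> {u, v} \<in> edges G"

inductive walk :: "'a graph \<Rightarrow> nat \<Rightarrow> 'a \<Rightarrow> 'a \<Rightarrow> bool" for G where
  walk0: "u \<in> verts G \<Longrightarrow> walk G 0 u u"
| walkS: "adj G u v \<Longrightarrow> walk G n v w \<Longrightarrow> walk G (Suc n) u w"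

definition dist_le :: "'a graph \<Rightarrow> nat \<Rightarrow> 'a \<Rightarrow> 'a \<Rightarrow> bool" where
  "dist_le G n u v \<longleftrightarrow> (\<exists>k\<le>n. walk G k u v)"

definition radius_le :: "'a graph \<Rightarrow> nat \<Rightarrow> bool" where
  "radius_le G r \<longleftrightarrow> (\<exists>c\<in>verts G. \<forall>x\<in>verts G. dist_le G r c x)"

text \<open>H is an r-shallow minor of G: there are pairwise disjoint branch sets in G,
  each inducing a subgraph of radius at most r, such that every edge of H is
  realised by an edge of G between the corresponding branch sets.
  (Minors of G have at most |V(G)| vertices, so representing H on the same
  vertex type loses nothing up to isomorphism, provided the type is large enough.)\<close>
definition shallow_minor :: "nat \<Rightarrow> 'a graph \<Rightarrow> 'a graph \<Rightarrow> bool" where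
  "shallow_minor r H G \<longleftrightarrow> simple_graph H \<and>
     (\<exists>\<phi> :: 'a \<Rightarrow> 'a set.
        (\<forall>h\<in>verts H. \<phi> h \<subseteq> verts G \<and> radius_le (induced G (\<phi> h)) r) \<and>
        (\<forall>h\<in>verts H. \<forall>h'\<in>verts H. h \<noteq> h' \<longrightarrow> \<phi> h \<inter> \<phi> h' = {}) \<and>
        (\<forall>u v. {u, v} \<in> edges H \<longrightarrow> (\<exists>x\<in>\<phi> u. \<exists>y\<in>\<phi> v. {x, y} \<in> edges G)))"

definition density :: "'a graph \<Rightarrow> real" where
  "density H = real (card (edges H)) / real (card (verts H))"

definition expansion_bounded_by :: "'a graph \<Rightarrow> (nat \<Rightarrow> real) \<Rightarrow> bool" where
  "expansion_bounded_by G f \<longleftrightarrow> (\<forall>r H. shallow_minor r H G \<longrightarrow> density H \<le> f r)"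

definition polynomial_expansion :: "'a graph set \<Rightarrow> bool" where
  "polynomial_expansion \<G> \<longleftrightarrow>
     (\<exists>p :: real poly. (\<forall>r::nat. poly p (real r) \<ge> 0) \<and>
        (\<forall>G\<in>\<G>. expansion_bounded_by G (\<lambda>r. poly p (real r))))"

definition is_property :: "('a graph \<Rightarrow> 'a set \<Rightarrow> bool) \<Rightarrow> bool" where
  "is_property \<pi> \<longleftrightarrow> (\<forall>G Z. \<pi> G Z \<longrightarrow> simple_graph G \<and> Z \<noteq> {} \<and> Z \<subseteq> verts G)"

definition finite_diameter :: "('a graph \<Rightarrow> 'a set \<Rightarrow> bool) \<Rightarrow> bool" where
  "finite_diameter \<pi> \<longleftrightarrow>
     (\<exists>D::nat. \<forall>G Z. \<pi> G Z \<longrightarrow> (\<forall>u\<in>Z. \<forall>v\<in>Z. dist_le (induced G Z) D u v))"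

definition packing :: "bool \<Rightarrow> ('a graph \<Rightarrow> 'a set \<Rightarrow> bool) \<Rightarrow> 'a graph \<Rightarrow> 'a set set \<Rightarrow> bool" where
  "packing ind \<pi> G P \<longleftrightarrow>
     (\<forall>X\<in>P. X \<subseteq> verts G \<and> \<pi> G X) \<and>
     (\<forall>X\<in>P. \<forall>Y\<in>P. X \<noteq> Y \<longrightarrow> X \<inter> Y = {}) \<and>
     (ind \<longrightarrow> (\<forall>X\<in>P. \<forall>Y\<in>P. X \<noteq> Y \<longrightarrow> (\<forall>x\<in>X. \<forall>y\<in>Y. {x, y} \<notin> edges G)))"

definition alpha :: "bool \<Rightarrow> ('a graph \<Rightarrow> 'a set \<Rightarrow> bool) \<Rightarrow> 'a graph \<Rightarrow> nat" where
  "alpha ind \<pi> G = Max {card P | P. packing ind \<pi> G P}"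

abbreviation alpha_pi where "alpha_pi \<equiv> alpha False"
abbreviation alpha'_pi where "alpha'_pi \<equiv> alpha True"

definition ls_step :: "bool \<Rightarrow> ('a graph \<Rightarrow> 'a set \<Rightarrow> bool) \<Rightarrow> 'a graph \<Rightarrow> nat
    \<Rightarrow> 'a set set \<Rightarrow> 'a set set \<Rightarrow> bool" where
  "ls_step ind \<pi> G c P P' \<longleftrightarrow>
     (\<exists>Y. Y \<subseteq> P \<and> card Y < c \<and> P - Y \<subseteq> P' \<and> packing ind \<pi> G P' \<and> card P' > card P)"

definition ls_results :: "bool \<Rightarrow> ('a graph \<Rightarrow> 'a set \<Rightarrow> bool) \<Rightarrow> 'a graph \<Rightarrow> nat \<Rightarrow> 'a set set set" where
  "ls_results ind \<pi> G c =
     {P. (ls_step ind \<pi> G c)\<^sup>*\<^sup>* {} P \<and> \<not> (\<exists>P'. ls_step ind \<pi> G c P P')}"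

end

theory Submission
  imports Defs
begin

text \<open>Compare a locally optimal packing \<open>P\<close> with an optimal packing \<open>Q\<close>. In the touch graph on
  \<open>F = P \<union> Q\<close> it suffices to cover all edges by pieces of bounded size whose sizes add up to
  at most \<open>(1 + \<delta>) |F|\<close>: inside each piece, local optimality says that the members of \<open>Q\<close> lying in
  no other piece are at most as many as the members of \<open>P\<close> in that piece.

  Such covers come from recursive balanced separators of relative size \<open>O(\<delta> / log\<^sup>2 |F|)\<close>, found by the
  method of Plotkin, Rao and Smith: grow a clique minor of small depth, and carve off a
  sparse cut whenever it cannot be extended. The touch graph itself need not be a minor of \<open>G\<close>, so
  the search for sparse cuts takes place in the touch graph while the branch sets of the clique
  minor live in \<open>G\<close>. As every vertex of \<open>G\<close> lies in at most two members of \<open>F\<close>, a branch set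
  with \<open>s\<close> vertices meets at most \<open>2 s\<close> members. A clique on \<open>h\<close> vertices has density \<open>(h - 1) / 2\<close>, so
  polynomial expansion bounds \<open>h\<close> by a polynomial in the depth, which is polylogarithmic in \<open>|F|\<close>.\<close>

section \<open>Walks and clique models\<close>

text \<open>This one relation covers the conflicts of both kinds of packing, so the plain and the
  induced search share a single proof. A non-empty set touches itself.\<close>

definition touch :: "'a graph \<Rightarrow> 'a set \<Rightarrow> 'a set \<Rightarrow> bool" where
  "touch G X Y \<longleftrightarrow> X \<inter> Y \<noteq> {} \<or> (\<exists>x\<in>X. \<exists>y\<in>Y. {x, y} \<in> edges G)"

text \<open>Records what is kept of the union of two packings: disjointness becomes the bound 2 on
  the members through a vertex. The notion passes to subfamilies, as the recursion requires.\<close>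

definition shallow_family :: "'a graph \<Rightarrow> nat \<Rightarrow> 'a set set \<Rightarrow> bool" where
  "shallow_family G D F \<longleftrightarrow> finite F \<and>
     (\<forall>X\<in>F. X \<noteq> {} \<and> X \<subseteq> verts G \<and> (\<forall>u\<in>X. \<forall>v\<in>X. dist_le (induced G X) D u v)) \<and>
     (\<forall>v. card {X\<in>F. v \<in> X} \<le> 2)"

text \<open>A complete graph as a shallow minor, given by its branch sets. The radius
  \<open>r\<close> is what an expansion bound speaks of; the size bound \<open>s\<close> limits how
  many family members a branch set can meet.\<close>

definition clique_model :: "'a graph \<Rightarrow> nat \<Rightarrow> nat \<Rightarrow> 'a set set \<Rightarrow> bool" where
  "clique_model G r s M \<longleftrightarrow> finite M \<and>
     (\<forall>m\<in>M. m \<subseteq> verts G \<and> card m \<le> s \<and> radius_le (induced G m) r) \<and>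
     (\<forall>m\<in>M. \<forall>m'\<in>M. m \<noteq> m' \<longrightarrow> m \<inter> m' = {} \<and> (\<exists>x\<in>m. \<exists>y\<in>m'. {x, y} \<in> edges G))"

lemma touch_sym: "touch G X Y \<longleftrightarrow> touch G Y X"
proof -
  have "touch G Y X" if t: "touch G X Y" for X Y
  proof (cases "X \<inter> Y = {}")
    case True
    then obtain x y where "x \<in> X" "y \<in> Y" "{x, y} \<in> edges G"
      using t by (auto simp: touch_def)
    moreover from this have "{y, x} \<in> edges G" by (simp add: insert_commute)
    ultimately show ?thesis unfolding touch_def by blast
  qed (auto simp: touch_def)
  then show ?thesis by blast
qed

section \<open>Walks and distances in induced subgraphs\<close>

lemma verts_induced [simp]: "verts (induced G T) = T"
  by (simp add: induced_def verts_def)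

lemma edges_induced [simp]: "edges (induced G T) = {e \<in> edges G. e \<subseteq> T}"
  by (simp add: induced_def edges_def)

lemma adj_induced: "adj (induced G T) u v \<longleftrightarrow> adj G u v \<and> u \<in> T \<and> v \<in> T"
  by (auto simp: adj_def)

lemma walk_induced_mono:
  assumes "walk (induced G T) k u v" "T \<subseteq> T'"
  shows "walk (induced G T') k u v"
  using assms(1)
proof induction
  case (walk0 u)
  then show ?case using assms(2) by (auto intro!: walk.walk0)
next
  case (walkS u v n w)
  then show ?case using assms(2) by (auto intro!: walk.walkS simp: adj_induced)
qed

lemma walk_trans: "walk G m u v \<Longrightarrow> walk G n v w \<Longrightarrow> walk G (m + n) u w"
  by (induction rule: walk.induct) (auto intro: walk.intros)

lemma adj_sym: "adj G u v \<Longrightarrow> adj G v u"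
  by (auto simp: adj_def insert_commute)

lemma walk_induced_sym: "walk (induced G T) k u v \<Longrightarrow> walk (induced G T) k v u"
proof (induction rule: walk.induct)
  case (walk0 u)
  then show ?case by (rule walk.walk0)
next
  case (walkS u v n w)
  have "walk (induced G T) 1 v u"
    using walkS.hyps(1) by (auto intro!: walk.intros simp: adj_induced intro: adj_sym)
  from walk_trans[OF walkS.IH this] show ?case by simp
qed

text \<open>\<open>T\<close> is the vertex set of the walk. Distances are measured inside
  \<open>T\<close>, so that \<open>T\<close> can later become part of a branch set.\<close>

lemma walk_support:
  assumes "walk (induced G W) n u v"
  shows "\<exists>T\<subseteq>W. finite T \<and> card T \<le> n + 1 \<and> u \<in> T \<and> v \<in> T \<and>
           (\<forall>x\<in>T. dist_le (induced G T) n u x)"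
  using assms
proof induction
  case (walk0 u)
  then show ?case
    by (intro exI[of _ "{u}"]) (auto simp: dist_le_def intro: walk.intros)
next
  case (walkS u v n w)
  then obtain T where T: "T \<subseteq> W" "finite T" "card T \<le> n + 1" "v \<in> T" "w \<in> T"
    "\<And>x. x \<in> T \<Longrightarrow> dist_le (induced G T) n v x" by blast
  have a: "adj (induced G (insert u T)) u v" "u \<in> W"
    using walkS.hyps(1) T(4) by (auto simp: adj_induced)
  have "dist_le (induced G (insert u T)) (Suc n) u x" if "x \<in> insert u T" for x
  proof (cases "x = u")
    case True
    then show ?thesis by (auto simp: dist_le_def intro!: exI[of _ 0] walk.walk0)
  next
    case False
    with that T(6) obtain k where "k \<le> n" "walk (induced G T) k v x"
      by (auto simp: dist_le_def)
    then show ?thesis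
      using walk.walkS[OF a(1) walk_induced_mono[of G T k v x]]
      by (auto simp: dist_le_def)
  qed
  moreover have "card (insert u T) \<le> Suc n + 1"
    using T(2,3) by (simp add: card_insert_if)
  ultimately show ?case
    using T(1,2,5) a(2) by (intro exI[of _ "insert u T"]) auto
qed

lemma dist_le_induced_mono:
  "dist_le (induced G T) k u v \<Longrightarrow> T \<subseteq> T' \<Longrightarrow> k \<le> k' \<Longrightarrow> dist_le (induced G T') k' u v"
  unfolding dist_le_def by (meson walk_induced_mono le_trans)

lemma shallow_family_dist:
  assumes "shallow_family G D F" "X \<in> F" "u \<in> X" "v \<in> X" "X \<subseteq> T" "D \<le> k"
  shows "dist_le (induced G T) k u v"
  using assms(1-4) by (intro dist_le_induced_mono[OF _ assms(5,6)]) (auto simp: shallow_family_def)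

lemma dist_le_induced_trans:
  assumes "dist_le (induced G T) a u v" "dist_le (induced G T) b v w"
  shows "dist_le (induced G T) (a + b) u w"
  using assms unfolding dist_le_def by (meson walk_trans add_mono)

lemma dist_le_induced_edge:
  assumes "simple_graph G" "u \<in> T" "v \<in> T" "u = v \<or> {u, v} \<in> edges G"
  shows "dist_le (induced G T) 1 u v"
proof (cases "u = v")
  case True
  then show ?thesis using assms by (auto simp: dist_le_def intro!: exI[of _ 0] walk.walk0)
next
  case False
  then have "walk (induced G T) 1 u v"
    using assms by (auto simp: adj_induced adj_def intro!: walk.intros)
  then show ?thesis by (auto simp: dist_le_def)
qed

lemma touchE:
  assumes "touch G X Y"
  obtains x y where "x \<in> X" "y \<in> Y" "x = y \<or> {x, y} \<in> edges G"
  using assms unfolding touch_def by blast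

text \<open>The walk is cut just before its first vertex in \<open>Z\<close>.\<close>

lemma walk_first_hit:
  assumes "walk (induced G K) n u v" "v \<in> Z" "u \<notin> Z"
  shows "\<exists>k<n. \<exists>y z. walk (induced G (K - Z)) k u y \<and> z \<in> Z \<inter> K \<and> {y, z} \<in> edges G"
  using assms
proof induction
  case (walk0 u)
  then show ?case by simp
next
  case (walkS u v n w)
  show ?case
  proof (cases "v \<in> Z")
    case True
    then show ?thesis
      using walkS.hyps(1) walkS.prems
      by (intro exI[of _ 0] conjI exI[of _ u] exI[of _ v])
         (auto simp: adj_induced adj_def intro!: walk.walk0)
  next
    case False
    then obtain k y z where k: "k < n" "walk (induced G (K - Z)) k v y" "z \<in> Z \<inter> K" "{y, z} \<in> edges G"
      using walkS by blast
    have "walk (induced G (K - Z)) (Suc k) u y"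
      using walkS.hyps(1) walkS.prems False k(2) by (intro walk.walkS[of _ u v]) (auto simp: adj_induced)
    then show ?thesis using k by (meson Suc_less_eq)
  qed
qed

lemma clique_model_card_le:
  assumes "expansion_bounded_by G f" "clique_model G r s M" "f r \<ge> 0"
  shows "real (card M) \<le> 2 * f r + 1"
proof (cases "M = {}")
  case True
  then show ?thesis using assms(3) by simp
next
  case False
  have fin: "finite M" using assms by (simp add: clique_model_def)
  have ne: "m \<noteq> {}" if "m \<in> M" for m
    using assms(2) that by (fastforce simp: clique_model_def radius_le_def)
  \<comment> \<open>\<open>shallow_minor\<close> expects a graph on the vertex type of
    \<open>G\<close>, so every branch set is named by one of its own vertices; disjointness makes
    the naming injective.\<close>
  define rep where "rep m = (SOME x. x \<in> m)" for m :: "'a set"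
  have rep: "rep m \<in> m" if "m \<in> M" for m
    using ne[OF that] by (simp add: rep_def some_in_eq)
  have disj: "m = m'" if "m \<in> M" "m' \<in> M" "x \<in> m" "x \<in> m'" for m m' x
    using assms(2) that unfolding clique_model_def by blast
  have inj: "inj_on rep M"
    by (rule inj_onI) (metis rep disj)
  define R where "R = rep ` M"
  define H where "H = (R, {e. e \<subseteq> R \<and> card e = 2})"
  have R: "finite R" "card R = card M" "R \<noteq> {}"
    using fin False by (auto simp: R_def card_image[OF inj])
  define \<phi> where "\<phi> = inv_into M rep"
  have \<phi>: "\<phi> h \<in> M" "h = rep (\<phi> h)" if "h \<in> R" for h
    using that by (auto simp: \<phi>_def R_def inv_into_into f_inv_into_f)
  have "shallow_minor r H G"
    unfolding shallow_minor_def
  proof (intro conjI exI[of _ \<phi>] ballI impI allI)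
    show "simple_graph H"
      using R(1) by (auto simp: simple_graph_def H_def verts_def edges_def card_2_iff)
  next
    fix h assume "h \<in> verts H"
    then show "\<phi> h \<subseteq> verts G" "radius_le (induced G (\<phi> h)) r"
      using \<phi>[of h] assms(2) by (auto simp: H_def verts_def clique_model_def)
  next
    fix h h' assume "h \<in> verts H" "h' \<in> verts H" "h \<noteq> h'"
    then show "\<phi> h \<inter> \<phi> h' = {}"
      using \<phi>[of h] \<phi>[of h'] disj[of "\<phi> h" "\<phi> h'"] by (force simp: H_def verts_def)
  next
    fix u v assume "{u, v} \<in> edges H"
    then have "u \<in> R" "v \<in> R" "u \<noteq> v" by (auto simp: H_def edges_def)
    then have "\<phi> u \<in> M" "\<phi> v \<in> M" "\<phi> u \<noteq> \<phi> v" using \<phi> by metis+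
    then show "\<exists>x\<in>\<phi> u. \<exists>y\<in>\<phi> v. {x, y} \<in> edges G"
      using assms(2) by (auto simp: clique_model_def)
  qed
  then have "density H \<le> f r" using assms(1) unfolding expansion_bounded_by_def by blast
  moreover have "card (edges H) = card M choose 2"
    using n_subsets[OF R(1), of 2] R(2) by (simp add: H_def edges_def)
  moreover have "card (verts H) = card M" using R by (simp add: H_def verts_def)
  ultimately have "real (card M choose 2) / real (card M) \<le> f r"
    by (simp add: density_def)
  moreover have "card M > 0" using False fin by (simp add: card_gt_0_iff)
  moreover have "real (card M choose 2) = real (card M) * (real (card M) - 1) / 2"
  proof -
    have "2 * (card M choose 2) = card M * (card M - 1)"
      unfolding choose_two by (rule dvd_mult_div_cancel) auto
    then have "2 * real (card M choose 2) = real (card M * (card M - 1))"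
      by (metis of_nat_mult of_nat_numeral)
    then show ?thesis using \<open>card M > 0\<close> by (simp add: of_nat_diff)
  qed
  ultimately show ?thesis by simp
qed

section \<open>Expansion in the touch graph\<close>

definition bdry :: "'a graph \<Rightarrow> 'a set set \<Rightarrow> 'a set set \<Rightarrow> 'a set set" where
  "bdry G B U = {Y \<in> B - U. \<exists>X\<in>U. touch G X Y}"

primrec fam_ball :: "'a graph \<Rightarrow> 'a set set \<Rightarrow> 'a set \<Rightarrow> nat \<Rightarrow> 'a set set" where
  "fam_ball G B X 0 = {X}"
| "fam_ball G B X (Suc q) = fam_ball G B X q \<union> bdry G B (fam_ball G B X q)"

lemma fam_ball_subset: "X \<in> B \<Longrightarrow> fam_ball G B X q \<subseteq> B"
  by (induction q) (auto simp: bdry_def)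

lemma fam_ball_self: "X \<in> fam_ball G B X q"
  by (induction q) auto

text \<open>While a ball has at most half of the members, expansion multiplies its size by at least
  1 + 1 / l per step. If that lasted for \<open>m\<close> steps, the ball would have at least |B|
  members.\<close>

lemma fam_ball_large:
  assumes "finite B" "X \<in> B" "l > 0"
    and exp: "\<And>U. U \<subseteq> B \<Longrightarrow> U \<noteq> {} \<Longrightarrow> 2 * card U \<le> card B \<Longrightarrow> card U < l * card (bdry G B U)"
    and m: "real (card B) \<le> (1 + 1 / real l) ^ m"
  shows "card B < 2 * card (fam_ball G B X m)"
proof (rule ccontr)
  assume neg: "\<not> ?thesis"
  have fin: "finite (fam_ball G B X q)" for q
    using fam_ball_subset[OF assms(2)] assms(1) finite_subset by blast
  have mono: "card (fam_ball G B X q) \<le> card (fam_ball G B X m)" if "q \<le> m" for q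
  proof -
    have "fam_ball G B X q \<subseteq> fam_ball G B X m"
      by (rule lift_Suc_mono_le[OF _ that]) auto
    then show ?thesis by (rule card_mono[OF fin])
  qed
  have "(1 + 1 / real l) ^ q \<le> real (card (fam_ball G B X q))" if "q \<le> m" for q
    using that
  proof (induction q)
    case 0
    then show ?case by simp
  next
    case (Suc q)
    let ?U = "fam_ball G B X q"
    have "2 * card ?U \<le> card B" using mono[of q] Suc.prems neg by simp
    then have "card ?U < l * card (bdry G B ?U)"
      using exp[OF fam_ball_subset[OF assms(2), of G q]] fam_ball_self[of X G B q] by blast
    then have "real (card ?U) \<le> real l * real (card (bdry G B ?U))"
      by (metis less_imp_le of_nat_le_iff of_nat_mult)
    then have *: "real (card ?U) / real l \<le> real (card (bdry G B ?U))"
      using \<open>l > 0\<close> by (simp add: field_simps)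
    have "card (fam_ball G B X (Suc q)) = card ?U + card (bdry G B ?U)"
      using assms(1) by (simp, subst card_Un_disjoint) (auto simp: fin bdry_def)
    then have "real (card (fam_ball G B X (Suc q))) \<ge> real (card ?U) + real (card ?U) / real l"
      using * by simp
    moreover have "(1 + 1 / real l) ^ Suc q \<le> (1 + 1 / real l) * real (card ?U)"
      using Suc by (simp add: mult_left_mono)
    ultimately show ?case by (simp add: algebra_simps)
  qed
  from this[of m] m have "card B \<le> card (fam_ball G B X m)" by linarith
  moreover have "card (fam_ball G B X m) > 0" using fin fam_ball_self by (metis card_gt_0_iff empty_iff)
  ultimately show False using neg by simp
qed

text \<open>Each layer costs one edge into the next member and at most \<open>D\<close> steps across
  it; the last \<open>D\<close> pays for crossing \<open>X\<close> itself.\<close>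

lemma fam_ball_dist:
  assumes "simple_graph G" "shallow_family G D F" "B \<subseteq> F" "X \<in> B"
    and "Y \<in> fam_ball G B X q" "x \<in> X" "y \<in> Y"
  shows "dist_le (induced G (\<Union>B)) (q * (D + 1) + D) x y"
  using assms(5,7)
proof (induction q arbitrary: Y y)
  case 0
  then show ?case
    using assms(2-4,6) by (intro shallow_family_dist[of G D F X]) auto
next
  case (Suc q)
  show ?case
  proof (cases "Y \<in> fam_ball G B X q")
    case True
    then show ?thesis
      using Suc.IH[of Y y] Suc.prems by (rule_tac dist_le_induced_mono) auto
  next
    case False
    then obtain Y' where Y': "Y' \<in> fam_ball G B X q" "touch G Y' Y" "Y \<in> B"
      using Suc.prems by (auto simp: bdry_def)
    obtain a b where ab: "a \<in> Y'" "b \<in> Y" "a = b \<or> {a, b} \<in> edges G"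
      using Y'(2) by (rule touchE)
    have "Y' \<in> B" using Y'(1) fam_ball_subset[OF assms(4)] by blast
    have "dist_le (induced G (\<Union>B)) (q * (D + 1) + D) x a" using Suc.IH[OF Y'(1) ab(1)] .
    moreover have "dist_le (induced G (\<Union>B)) 1 a b"
      using ab Y' \<open>Y' \<in> B\<close> by (intro dist_le_induced_edge assms(1)) auto
    moreover have "dist_le (induced G (\<Union>B)) D b y"
      using assms(2,3) Y'(3) ab(2) Suc.prems(2) by (intro shallow_family_dist[of G D F Y]) auto
    ultimately have "dist_le (induced G (\<Union>B)) (q * (D + 1) + D + 1 + D) x y"
      by (rule dist_le_induced_trans[OF dist_le_induced_trans])
    then show ?thesis by (simp add: algebra_simps)
  qed
qed

lemma dist_le_induced_sym: "dist_le (induced G T) k u v \<Longrightarrow> dist_le (induced G T) k v u"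
proof -
  assume "dist_le (induced G T) k u v"
  then obtain n where "n \<le> k" "walk (induced G T) n u v" by (auto simp: dist_le_def)
  from this(1) walk_induced_sym[OF this(2)] show ?thesis by (auto simp: dist_le_def)
qed

text \<open>The balls about \<open>X\<close> and \<open>Y\<close> each contain more than half of
  \<open>B\<close>, so they share a member \<open>Z\<close>; the walk goes through a vertex of
  \<open>Z\<close>.\<close>

lemma expanding_family_dist:
  assumes "simple_graph G" "shallow_family G D F" "B \<subseteq> F" "l > 0"
    and exp: "\<And>U. U \<subseteq> B \<Longrightarrow> U \<noteq> {} \<Longrightarrow> 2 * card U \<le> card B \<Longrightarrow> card U < l * card (bdry G B U)"
    and m: "real (card B) \<le> (1 + 1 / real l) ^ m"
    and "X \<in> B" "Y \<in> B" "x \<in> X" "y \<in> Y"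
  shows "dist_le (induced G (\<Union>B)) (2 * (m * (D + 1) + D)) x y"
proof -
  have fin: "finite B" using assms(2,3) finite_subset by (auto simp: shallow_family_def)
  have sub: "fam_ball G B X m \<subseteq> B" "fam_ball G B Y m \<subseteq> B"
    using fam_ball_subset \<open>X \<in> B\<close> \<open>Y \<in> B\<close> by metis+
  have "fam_ball G B X m \<inter> fam_ball G B Y m \<noteq> {}"
  proof
    assume "fam_ball G B X m \<inter> fam_ball G B Y m = {}"
    moreover have "finite (fam_ball G B X m)" "finite (fam_ball G B Y m)"
      using sub fin by (auto intro: finite_subset)
    ultimately have "card (fam_ball G B X m) + card (fam_ball G B Y m)
        = card (fam_ball G B X m \<union> fam_ball G B Y m)"
      by (simp add: card_Un_disjoint)
    also have "\<dots> \<le> card B"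
      using sub fin by (intro card_mono) auto
    finally show False
      using fam_ball_large[OF fin \<open>X \<in> B\<close> \<open>l > 0\<close> exp m] fam_ball_large[OF fin \<open>Y \<in> B\<close> \<open>l > 0\<close> exp m]
      by simp
  qed
  then obtain Z where Z: "Z \<in> fam_ball G B X m" "Z \<in> fam_ball G B Y m" by blast
  then have "Z \<in> F" using sub \<open>B \<subseteq> F\<close> by blast
  then obtain z where z: "z \<in> Z" using assms(2) by (force simp: shallow_family_def)
  have "dist_le (induced G (\<Union>B)) (m * (D + 1) + D) x z"
    using fam_ball_dist[OF assms(1-3) \<open>X \<in> B\<close> Z(1) \<open>x \<in> X\<close> z] .
  moreover have "dist_le (induced G (\<Union>B)) (m * (D + 1) + D) z y"
    using fam_ball_dist[OF assms(1-3) \<open>Y \<in> B\<close> Z(2) \<open>y \<in> Y\<close> z] by (rule dist_le_induced_sym)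
  ultimately show ?thesis unfolding mult_2 by (rule dist_le_induced_trans)
qed

section \<open>Balanced separators\<close>

text \<open>\<open>A\<close> is finished and \<open>B\<close> remains to be split. The separator consists of \<open>C\<close>, the boundaries of
  carved-off sets, whose size is charged to \<open>A\<close>, and of the members met by a branch set in \<open>M\<close>.\<close>

definition sep_state :: "'a graph \<Rightarrow> 'a set set \<Rightarrow> nat \<Rightarrow> nat \<Rightarrow> nat \<Rightarrow>
    'a set set \<Rightarrow> 'a set set \<Rightarrow> 'a set set \<Rightarrow> 'a set set \<Rightarrow> bool" where
  "sep_state G F l r s A B C M \<longleftrightarrow> A \<subseteq> F \<and> B \<subseteq> F \<and> C \<subseteq> F \<and> A \<inter> B = {} \<and>
     (\<forall>X\<in>A. \<forall>Y\<in>B. \<not> touch G X Y) \<and> l * card C \<le> card A \<and> 3 * card A \<le> 2 * card F \<and>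
     F \<subseteq> A \<union> B \<union> C \<union> {X \<in> F. X \<inter> \<Union>M \<noteq> {}} \<and> (\<forall>X\<in>B. X \<inter> \<Union>M = {}) \<and>
     clique_model G r s M"

text \<open>A short walk from \<open>B\<close> avoids all branch sets and ends next to
  \<open>m\<close>. The bound \<open>D + 1\<close> allows one edge from \<open>B\<close> into some
  member of the family and \<open>D\<close> steps inside that member.\<close>

definition accessible :: "'a graph \<Rightarrow> nat \<Rightarrow> 'a set set \<Rightarrow> 'a set set \<Rightarrow> 'a set \<Rightarrow> bool" where
  "accessible G D B M m \<longleftrightarrow> (\<exists>X\<in>B. \<exists>x\<in>X. \<exists>y. \<exists>z\<in>m.
     dist_le (induced G (verts G - \<Union>M)) (D + 1) x y \<and> {y, z} \<in> edges G)"

text \<open>If \<open>K\<close> touched \<open>X\<close>, a walk could enter \<open>K\<close> at the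
  contact and run inside \<open>K\<close> until just before \<open>m\<close>. As \<open>K\<close>
  misses the other branch sets, the walk avoids them all, and \<open>m\<close> would be
  accessible.\<close>

lemma inaccessible_untouched:
  assumes "simple_graph G" "shallow_family G D F" "B \<subseteq> F" "m \<in> M" "K \<in> F"
    and "\<forall>X\<in>B. X \<inter> \<Union>M = {}" "\<not> accessible G D B M m"
    and K: "K \<inter> m \<noteq> {}" "K \<inter> \<Union>(M - {m}) = {}" and "X \<in> B"
  shows "\<not> touch G K X"
proof
  assume "touch G K X"
  then have "touch G X K" by (simp add: touch_sym)
  then obtain x w where xw: "x \<in> X" "w \<in> K" "x = w \<or> {x, w} \<in> edges G" by (rule touchE)
  have V: "X \<subseteq> verts G" "K \<subseteq> verts G"
    using assms(2,3,5) \<open>X \<in> B\<close> by (auto simp: shallow_family_def)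
  have x: "x \<in> verts G - \<Union>M" using V xw(1) assms(6) \<open>X \<in> B\<close> by blast
  have KM: "K - m \<subseteq> verts G - \<Union>M" using V K(2) by blast
  have "\<exists>y. \<exists>z\<in>m. dist_le (induced G (verts G - \<Union>M)) (D + 1) x y \<and> {y, z} \<in> edges G"
  proof (cases "w \<in> m")
    \<comment> \<open>The contact already lies in \<open>m\<close>, so the walk of length 0 at
      \<open>x\<close> is enough.\<close>
    case True
    then have "{x, w} \<in> edges G" using xw x \<open>m \<in> M\<close> by blast
    moreover have "dist_le (induced G (verts G - \<Union>M)) (D + 1) x x"
      using x by (auto simp: dist_le_def intro!: exI[of _ 0] walk.walk0)
    ultimately show ?thesis using True by blast
  next
    case False
    obtain v where v: "v \<in> K" "v \<in> m" using K(1) by blast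
    have "dist_le (induced G K) D w v"
      using assms(2,5) xw(2) v(1) by (auto simp: shallow_family_def)
    then obtain n where n: "n \<le> D" "walk (induced G K) n w v" by (auto simp: dist_le_def)
    obtain k y z where k: "k < n" "walk (induced G (K - m)) k w y" "z \<in> m \<inter> K" "{y, z} \<in> edges G"
      using walk_first_hit[OF n(2) v(2) False] by blast
    have "dist_le (induced G (verts G - \<Union>M)) D w y"
      using walk_induced_mono[OF k(2) KM] k(1) n(1) by (auto simp: dist_le_def intro!: exI[of _ k])
    moreover have "dist_le (induced G (verts G - \<Union>M)) 1 x w"
      using x KM xw False by (intro dist_le_induced_edge assms(1)) auto
    ultimately have "dist_le (induced G (verts G - \<Union>M)) (1 + D) x y"
      using dist_le_induced_trans by metis
    then show ?thesis using k by auto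
  qed
  then show False using assms(7) \<open>X \<in> B\<close> xw(1) unfolding accessible_def by blast
qed

text \<open>A branch set with no access to \<open>B\<close> can be dropped: the members it kept in the separator
  no longer touch \<open>B\<close>, so they move to the finished side.\<close>

lemma sep_state_drop:
  assumes st: "sep_state G F l r s A B C M" and G: "simple_graph G" "shallow_family G D F"
    and m: "m \<in> M" "\<not> accessible G D B M m" and B: "2 * card F < 3 * card B"
  shows "\<exists>A'. sep_state G F l r s A' B C (M - {m})"
proof -
  have fin: "finite F" using G by (simp add: shallow_family_def)
  \<comment> \<open>Members whose contact with the branch sets is confined to \<open>m\<close>; once
    \<open>m\<close> is gone, nothing else accounts for them.\<close>
  define N where "N = {K \<in> F - B - C. K \<inter> \<Union>(M - {m}) = {}} - A"
  have AB: "A \<subseteq> F" "B \<subseteq> F" "C \<subseteq> F" "A \<inter> B = {}" and nt: "\<forall>X\<in>A. \<forall>Y\<in>B. \<not> touch G X Y"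
    and l: "l * card C \<le> card A" and cov: "F \<subseteq> A \<union> B \<union> C \<union> {X \<in> F. X \<inter> \<Union>M \<noteq> {}}"
    and BM: "\<forall>X\<in>B. X \<inter> \<Union>M = {}" and M: "clique_model G r s M"
    using st by (auto simp: sep_state_def)
  have N: "N \<subseteq> F" "N \<inter> B = {}" by (auto simp: N_def)
  have "\<not> touch G K X" if "K \<in> N" "X \<in> B" for K X
  proof -
    have "K \<in> F" "K \<inter> \<Union>(M - {m}) = {}" "K \<inter> \<Union>M \<noteq> {}"
      using that cov by (auto simp: N_def)
    moreover from this have "K \<inter> m \<noteq> {}" by blast
    ultimately show ?thesis
      using inaccessible_untouched[OF G AB(2) m(1) _ BM m(2)] that by blast
  qed
  \<comment> \<open>\<open>B\<close> has more than two thirds of \<open>F\<close>, so what is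
    disjoint from it has less than one third.\<close>
  moreover have "3 * card (A \<union> N) \<le> 2 * card F"
  proof -
    have "card (A \<union> N) + card B = card (A \<union> N \<union> B)"
      using AB N fin by (intro card_Un_disjoint[symmetric]) (auto intro: finite_subset)
    also have "\<dots> \<le> card F" using AB N fin by (intro card_mono) auto
    finally show ?thesis using B by simp
  qed
  moreover have "card A \<le> card (A \<union> N)"
    using AB N fin by (intro card_mono) (auto intro: finite_subset)
  moreover have "clique_model G r s (M - {m})" using M by (auto simp: clique_model_def)
  moreover have "F \<subseteq> (A \<union> N) \<union> B \<union> C \<union> {X \<in> F. X \<inter> \<Union>(M - {m}) \<noteq> {}}"
    by (auto simp: N_def)
  moreover have "\<forall>X\<in>B. X \<inter> \<Union>(M - {m}) = {}" using BM by blast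
  ultimately have "sep_state G F l r s (A \<union> N) B C (M - {m})"
    unfolding sep_state_def using AB N nt l by auto
  then show ?thesis by blast
qed

text \<open>The boundary of \<open>U\<close> joins the separator and is paid for by the members of
  \<open>U\<close> that join \<open>A\<close>. What remains of \<open>B\<close> no longer touches
  \<open>U\<close>.\<close>

lemma sep_state_carve:
  assumes st: "sep_state G F l r s A B C M" and fin: "finite F"
    and U: "U \<subseteq> B" "2 * card U \<le> card B" "l * card (bdry G B U) \<le> card U"
    and B: "2 * card F < 3 * card B"
  shows "sep_state G F l r s (A \<union> U) (B - U - bdry G B U) (C \<union> bdry G B U) M"
proof -
  have AB: "A \<subseteq> F" "B \<subseteq> F" "C \<subseteq> F" "A \<inter> B = {}" and nt: "\<forall>X\<in>A. \<forall>Y\<in>B. \<not> touch G X Y"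
    and l: "l * card C \<le> card A" and cov: "F \<subseteq> A \<union> B \<union> C \<union> {X \<in> F. X \<inter> \<Union>M \<noteq> {}}"
    using st by (auto simp: sep_state_def)
  have finA: "finite A" "finite B" "finite C" using AB fin finite_subset by blast+
  have N: "bdry G B U \<subseteq> B" by (auto simp: bdry_def)
  have "card A + card B \<le> card F"
    using AB fin finA card_mono[of F "A \<union> B"] by (simp add: card_Un_disjoint)
  moreover have cAU: "card (A \<union> U) = card A + card U"
    using AB U finA by (intro card_Un_disjoint) (auto intro: finite_subset)
  \<comment> \<open>|A| + |U| \<le> |F| - |B| + |B| / 2 = |F| - |B| / 2, which is below 2 |F| /
    3.\<close>
  ultimately have "3 * card (A \<union> U) \<le> 2 * card F" using B U by simp
  moreover have "l * card (C \<union> bdry G B U) \<le> card (A \<union> U)"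
  proof -
    have "l * card (C \<union> bdry G B U) \<le> l * card C + l * card (bdry G B U)"
      unfolding distrib_left[symmetric] by (intro mult_left_mono card_Un_le) auto
    then show ?thesis using l U(3) cAU by simp
  qed
  moreover have "\<not> touch G X Y" if "X \<in> A \<union> U" "Y \<in> B - U - bdry G B U" for X Y
    using that nt U(1) by (auto simp: bdry_def)
  ultimately show ?thesis
    using st U(1) N unfolding sep_state_def by auto
qed

text \<open>The new branch set is a union of short walks, one to each old branch set, all starting at
  the same vertex \<open>x\<close>.\<close>

lemma sep_state_extend:
  assumes st: "sep_state G F l r s A B C M" and G: "simple_graph G" "shallow_family G D F"
    and "l > 0" and acc: "\<And>m. m \<in> M \<Longrightarrow> accessible G D B M m"
    and exp: "\<And>U. U \<subseteq> B \<Longrightarrow> U \<noteq> {} \<Longrightarrow> 2 * card U \<le> card B \<Longrightarrow> card U < l * card (bdry G B U)"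
    and q: "real (card B) \<le> (1 + 1 / real l) ^ q" "r = (2 * q + 3) * (D + 1)"
    and s: "card M * (r + 1) + 1 \<le> s" and B: "B \<noteq> {}"
  shows "\<exists>T B'. sep_state G F l r s A B' C (insert T M) \<and> B' \<subset> B \<and> T \<notin> M"
proof -
  have AB: "A \<subseteq> F" "B \<subseteq> F" "C \<subseteq> F" "A \<inter> B = {}"
    and BM: "\<forall>X\<in>B. X \<inter> \<Union>M = {}" and M: "clique_model G r s M"
    using st by (auto simp: sep_state_def)
  let ?W = "verts G - \<Union>M"
  obtain X where X: "X \<in> B" using B by blast
  then obtain x where x: "x \<in> X" using AB G(2) by (force simp: shallow_family_def)
  have BW: "\<Union>B \<subseteq> ?W" using AB BM G(2) by (fastforce simp: shallow_family_def)
  have xW: "x \<in> ?W" using x X BW by blast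
  define good where "good m T \<longleftrightarrow> T \<subseteq> ?W \<and> finite T \<and> card T \<le> r + 1 \<and> x \<in> T \<and>
      (\<forall>u\<in>T. dist_le (induced G T) r x u) \<and> (\<exists>y\<in>T. \<exists>z\<in>m. {y, z} \<in> edges G)" for m T
  have "\<exists>T. good m T"
    if m: "m \<in> M" for m
  proof -
    obtain Y a y z where Y: "Y \<in> B" "a \<in> Y" "z \<in> m" "{y, z} \<in> edges G"
      and ay: "dist_le (induced G ?W) (D + 1) a y"
      using acc[OF m] by (auto simp: accessible_def)
    \<comment> \<open>First leg: from \<open>x\<close> to \<open>a\<close> inside
      \<open>\<Union>B\<close>, short by expansion. Second leg: the access walk from
      \<open>a\<close> to a neighbour of \<open>m\<close>. Both avoid the old branch sets.\<close>
    have "dist_le (induced G (\<Union>B)) (2 * (q * (D + 1) + D)) x a"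
      using expanding_family_dist[OF G AB(2) \<open>l > 0\<close> exp q(1) X Y(1) x Y(2)] .
    then have "dist_le (induced G ?W) (2 * (q * (D + 1) + D)) x a"
      by (rule dist_le_induced_mono[OF _ BW]) simp
    then have "dist_le (induced G ?W) (2 * (q * (D + 1) + D) + (D + 1)) x y"
      using ay by (rule dist_le_induced_trans)
    then obtain n where n: "n \<le> 2 * (q * (D + 1) + D) + (D + 1)" "walk (induced G ?W) n x y"
      by (auto simp: dist_le_def)
    \<comment> \<open>The two legs have total length at most 2 q (D + 1) + 3 D + 1, which (2 q + 3)
      (D + 1) dominates.\<close>
    have nr: "n \<le> r" using n(1) q(2) by (simp add: algebra_simps)
    obtain T where T: "T \<subseteq> ?W" "finite T" "card T \<le> n + 1" "x \<in> T" "y \<in> T"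
      "\<And>u. u \<in> T \<Longrightarrow> dist_le (induced G T) n x u"
      using walk_support[OF n(2)] by blast
    have "dist_le (induced G T) r x u" if "u \<in> T" for u
      using T(6)[OF that] by (rule dist_le_induced_mono[OF _ order.refl nr])
    then show ?thesis
      unfolding good_def using T nr Y by (intro exI[of _ T]) auto
  qed
  then obtain t where "\<And>m. m \<in> M \<Longrightarrow> good m (t m)" by metis
  then have t: "t m \<subseteq> ?W" "finite (t m)" "card (t m) \<le> r + 1" "x \<in> t m"
    "\<And>u. u \<in> t m \<Longrightarrow> dist_le (induced G (t m)) r x u" "\<exists>y\<in>t m. \<exists>z\<in>m. {y, z} \<in> edges G"
    if "m \<in> M" for m
    using that by (auto simp: good_def)
  \<comment> \<open>Inserting \<open>x\<close> makes \<open>T\<close> non-empty even for empty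
    \<open>M\<close>; this vertex is the + 1 in the bound on \<open>s\<close>.\<close>
  define T where "T = insert x (\<Union>(t ` M))"
  have finM: "finite M" using M by (simp add: clique_model_def)
  have TW: "T \<subseteq> ?W" using t(1) xW by (auto simp: T_def)
  have xT: "x \<in> T" by (simp add: T_def)
  have "card (\<Union>(t ` M)) \<le> (\<Sum>m\<in>M. card (t m))" by (rule card_UN_le[OF finM])
  also have "\<dots> \<le> card M * (r + 1)" using sum_bounded_above[of M "\<lambda>m. card (t m)" "r + 1"] t(3) by simp
  finally have "card (\<Union>(t ` M)) \<le> card M * (r + 1)" .
  moreover have "card T \<le> Suc (card (\<Union>(t ` M)))"
    using finM t(2) by (auto simp: T_def card_insert_if)
  ultimately have cT: "card T \<le> s" using s by simp
  have "dist_le (induced G T) r x u" if u: "u \<in> T" for u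
  proof (cases "u = x")
    case True
    then show ?thesis using xT by (auto simp: dist_le_def intro!: exI[of _ 0] walk.walk0)
  next
    case False
    then obtain m where "m \<in> M" "u \<in> t m" using u by (auto simp: T_def)
    then show ?thesis
      using t(5) by (intro dist_le_induced_mono[of G "t m" r x u T r]) (auto simp: T_def)
  qed
  then have rad: "radius_le (induced G T) r" using xT by (auto simp: radius_le_def)
  have disj: "T \<inter> m = {}" "m \<inter> T = {}" if "m \<in> M" for m using TW that by blast+
  have edge: "\<exists>a\<in>T. \<exists>b\<in>m. {a, b} \<in> edges G" if "m \<in> M" for m
    using t(6)[OF that] that by (auto simp: T_def)
  have edge': "\<exists>a\<in>m. \<exists>b\<in>T. {a, b} \<in> edges G" if m: "m \<in> M" for m
  proof -
    obtain a b where "a \<in> T" "b \<in> m" "{a, b} \<in> edges G" using edge[OF m] by blast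
    moreover from this have "{b, a} \<in> edges G" by (simp add: insert_commute)
    ultimately show ?thesis by blast
  qed
  have cm: "clique_model G r s (insert T M)"
    unfolding clique_model_def
  proof (intro conjI ballI impI)
    fix m assume "m \<in> insert T M"
    then show "m \<subseteq> verts G" "card m \<le> s" "radius_le (induced G m) r"
      using M TW cT rad by (auto simp: clique_model_def)
  next
    fix m m' assume "m \<in> insert T M" "m' \<in> insert T M" "m \<noteq> m'"
    then consider "m \<in> M" "m' \<in> M" | "m = T" "m' \<in> M" | "m \<in> M" "m' = T" by blast
    then have "m \<inter> m' = {} \<and> (\<exists>x\<in>m. \<exists>y\<in>m'. {x, y} \<in> edges G)"
    proof cases
      case 1
      then show ?thesis using M \<open>m \<noteq> m'\<close> unfolding clique_model_def by blast
    qed (use disj edge edge' in simp_all)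
    then show "m \<inter> m' = {}" "\<exists>x\<in>m. \<exists>y\<in>m'. {x, y} \<in> edges G" by blast+
  qed (use finM in simp)
  define B' where "B' = {Y \<in> B. Y \<inter> T = {}}"
  \<comment> \<open>\<open>B\<close> shrinks strictly because \<open>X\<close> contains the vertex
    \<open>x\<close> of \<open>T\<close>.\<close>
  have "X \<in> B - B'" using X x xT by (auto simp: B'_def)
  then have "B' \<subset> B" by (auto simp: B'_def)
  moreover have "T \<notin> M" using disj(1) xT by blast
  moreover have "sep_state G F l r s A B' C (insert T M)"
  proof -
    have "F \<subseteq> A \<union> B' \<union> C \<union> {X \<in> F. X \<inter> \<Union>(insert T M) \<noteq> {}}"
    proof
      fix Y assume "Y \<in> F"
      then consider "Y \<in> A \<union> C" | "Y \<in> B" | "Y \<inter> \<Union>M \<noteq> {}"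
        using st unfolding sep_state_def by blast
      then show "Y \<in> A \<union> B' \<union> C \<union> {X \<in> F. X \<inter> \<Union>(insert T M) \<noteq> {}}"
        using \<open>Y \<in> F\<close> by cases (auto simp: B'_def)
    qed
    moreover have "\<forall>X\<in>B'. X \<inter> \<Union>(insert T M) = {}" using BM by (auto simp: B'_def)
    moreover have "B' \<subseteq> F" "A \<inter> B' = {}" "\<forall>X\<in>A. \<forall>Y\<in>B'. \<not> touch G X Y"
      using st by (auto simp: sep_state_def B'_def)
    ultimately show ?thesis using st cm unfolding sep_state_def by simp
  qed
  ultimately show ?thesis by blast
qed

text \<open>The branch sets have at most |M| s vertices together, and each vertex lies in at most
  two members.\<close>

lemma shallow_family_hit_card:
  assumes "shallow_family G D F" "finite M" "\<And>m. m \<in> M \<Longrightarrow> finite m \<and> card m \<le> s"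
  shows "card {X \<in> F. X \<inter> \<Union>M \<noteq> {}} \<le> 2 * (card M * s)"
proof -
  have U: "finite (\<Union>M)" using assms by blast
  have "{X \<in> F. X \<inter> \<Union>M \<noteq> {}} = (\<Union>v\<in>\<Union>M. {X \<in> F. v \<in> X})" by auto
  also have "card \<dots> \<le> (\<Sum>v\<in>\<Union>M. card {X \<in> F. v \<in> X})" by (rule card_UN_le[OF U])
  also have "\<dots> \<le> card (\<Union>M) * 2"
    using assms(1) sum_bounded_above[of "\<Union>M" "\<lambda>v. card {X \<in> F. v \<in> X}" 2]
    by (simp add: shallow_family_def)
  also have "card (\<Union>M) \<le> (\<Sum>m\<in>M. card m)" using card_UN_le[OF assms(2), of id] by simp
  also have "\<dots> \<le> card M * s" using sum_bounded_above[of M card s] assms(3) by simp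
  finally show ?thesis by simp
qed

text \<open>Take a state that minimises |B| (h + 1) + |M|. If \<open>B\<close> had more than two
  thirds of \<open>F\<close>, one of three moves would lower this measure: dropping an inaccessible
  branch set, carving off a set with sparse boundary, or, when neither is possible, adding a branch
  set.\<close>

lemma shallow_family_separator:
  assumes G: "simple_graph G" "shallow_family G D F" and "l > 0"
    and bound: "\<forall>M s. clique_model G r s M \<longrightarrow> card M \<le> h"
    and q: "real (card F) \<le> (1 + 1 / real l) ^ q" "r = (2 * q + 3) * (D + 1)"
  shows "\<exists>A B. A \<subseteq> F \<and> B \<subseteq> F \<and> A \<inter> B = {} \<and> (\<forall>X\<in>A. \<forall>Y\<in>B. \<not> touch G X Y) \<and>
           3 * card A \<le> 2 * card F \<and> 3 * card B \<le> 2 * card F \<and>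
           l * card (F - A - B) \<le> card F + 2 * l * h * (h * (r + 1) + 1)"
proof -
  have finF: "finite F" using G by (simp add: shallow_family_def)
  have clique: "card M \<le> h" if "clique_model G r s M" for M s using bound that by blast
  \<comment> \<open>Room for \<open>h\<close> walks with \<open>r + 1\<close> vertices each and one
    more vertex.\<close>
  define s where "s = h * (r + 1) + 1"
  \<comment> \<open>Since |M| \<le> h, the weight \<open>h + 1\<close> lets the loss of one member
    of \<open>B\<close> outweigh any change of \<open>M\<close>: the order is lexicographic.\<close>
  define f where "f = (\<lambda>(A :: 'a set set, B :: 'a set set, C :: 'a set set, M :: 'a set set).
     card B * (h + 1) + card M)"
  define Q where "Q = (\<lambda>(A, B, C, M). sep_state G F l r s A B C M)"
  have "Q ({}, F, {}, {})"
    by (auto simp: Q_def sep_state_def clique_model_def)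
  then obtain S where S: "Q S" "\<And>S'. Q S' \<Longrightarrow> f S \<le> f S'"
    using ex_has_least_nat[of Q _ f] by blast
  obtain A B C M where ABCM: "S = (A, B, C, M)" by (cases S)
  have st: "sep_state G F l r s A B C M" using S by (simp add: Q_def ABCM)
  have least: "card B * (h + 1) + card M \<le> card B' * (h + 1) + card M'"
    if "sep_state G F l r s A' B' C' M'" for A' B' C' M'
    using S(2)[of "(A', B', C', M')"] that by (simp add: Q_def f_def ABCM)
  have AB: "A \<subseteq> F" "B \<subseteq> F" "C \<subseteq> F" "A \<inter> B = {}" and nt: "\<forall>X\<in>A. \<forall>Y\<in>B. \<not> touch G X Y"
    and l: "l * card C \<le> card A" and cA: "3 * card A \<le> 2 * card F"
    and cov: "F \<subseteq> A \<union> B \<union> C \<union> {X \<in> F. X \<inter> \<Union>M \<noteq> {}}" and M: "clique_model G r s M"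
    using st by (auto simp: sep_state_def)
  have finB: "finite B" and finC: "finite C" and finM: "finite M"
    using AB finF finite_subset M by (auto simp: clique_model_def)
  have shrink: False if B': "B' \<subset> B" and st': "sep_state G F l r s A' B' C' M'" for A' B' C' M'
  proof -
    have "card M' \<le> h" using st' clique by (auto simp: sep_state_def)
    moreover have "(card B' + 1) * (h + 1) \<le> card B * (h + 1)"
      using psubset_card_mono[OF finB B'] by (intro mult_right_mono) auto
    ultimately show False using least[OF st'] by simp
  qed
  have "3 * card B \<le> 2 * card F"
  proof (rule ccontr)
    assume "\<not> ?thesis"
    then have big: "2 * card F < 3 * card B" by simp
    have acc: "accessible G D B M m" if "m \<in> M" for m
    proof (rule ccontr)
      assume "\<not> accessible G D B M m"
      then obtain A' where "sep_state G F l r s A' B C (M - {m})"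
        using sep_state_drop[OF st G \<open>m \<in> M\<close> _ big] by blast
      from least[OF this] show False using that finM card_Diff1_less[of M m] by simp
    qed
    have exp: "card U < l * card (bdry G B U)"
      if "U \<subseteq> B" "U \<noteq> {}" "2 * card U \<le> card B" for U
    proof (rule ccontr)
      assume "\<not> ?thesis"
      then have "sep_state G F l r s (A \<union> U) (B - U - bdry G B U) (C \<union> bdry G B U) M"
        using sep_state_carve[OF st finF that(1,3) _ big] by simp
      then show False using shrink[rotated] that by blast
    qed
    have "card B \<le> card F" using AB finF by (simp add: card_mono)
    then have "real (card B) \<le> (1 + 1 / real l) ^ q" using q(1) by linarith
    moreover have "card M * (r + 1) + 1 \<le> s"
      using clique[OF M] by (simp add: s_def del: mult_Suc_right add: mult_right_mono)
    moreover have "B \<noteq> {}" using big by auto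
    ultimately obtain T B' where "sep_state G F l r s A B' C (insert T M)" "B' \<subset> B"
      using sep_state_extend[OF st G \<open>l > 0\<close> acc exp _ q(2)] by blast
    then show False using shrink by blast
  qed
  \<comment> \<open>A separator member lies in \<open>C\<close>, where l |C| \<le> |A|, or meets one
    of at most \<open>h\<close> branch sets of size at most \<open>s\<close>.\<close>
  moreover have "l * card (F - A - B) \<le> card F + 2 * l * h * s"
  proof -
    have finm: "finite m \<and> card m \<le> s" if "m \<in> M" for m
      using M G(1) that finite_subset by (auto simp: clique_model_def simple_graph_def)
    have "card (F - A - B) \<le> card (C \<union> {X \<in> F. X \<inter> \<Union>M \<noteq> {}})"
      using cov finF finC by (intro card_mono) auto
    also have "\<dots> \<le> card C + card {X \<in> F. X \<inter> \<Union>M \<noteq> {}}" by (rule card_Un_le)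
    also have "\<dots> \<le> card C + 2 * (card M * s)"
      using shallow_family_hit_card[OF G(2) finM finm] by simp
    also have "\<dots> \<le> card C + 2 * (h * s)" using clique[OF M] by (simp add: mult_right_mono)
    finally have "l * card (F - A - B) \<le> l * (card C + 2 * (h * s))" by simp
    also have "\<dots> = l * card C + 2 * l * h * s" by (simp add: algebra_simps)
    also have "l * card C \<le> card F" using l AB finF card_mono[of F A] by simp
    finally show ?thesis by simp
  qed
  ultimately show ?thesis
    using AB nt cA unfolding s_def by blast
qed

section \<open>Covers by pieces of bounded size\<close>

lemma shallow_family_subset:
  assumes "shallow_family G D F" "F' \<subseteq> F"
  shows "shallow_family G D F'"
proof -
  have fin: "finite F" using assms by (simp add: shallow_family_def)
  have "card {X \<in> F'. v \<in> X} \<le> card {X \<in> F. v \<in> X}" for v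
    using assms(2) fin by (intro card_mono) auto
  then show ?thesis
    using assms finite_subset[OF assms(2) fin] unfolding shallow_family_def
    by (meson le_trans subsetD)
qed

text \<open>The factor \<open>1 + \<epsilon> * (1 - 1 / (j + 1))\<close> stays below \<open>1 + \<epsilon>\<close> and grows with the level \<open>j\<close>
  just enough to pay for a separator of relative size \<open>\<epsilon> / (2 * (j + 1) * (j + 2))\<close>.\<close>

lemma shallow_family_cover:
  fixes \<epsilon> :: real
  assumes "0 < \<epsilon>" "\<epsilon> \<le> 1" "k > 0"
    and sep: "\<And>F. shallow_family G D F \<Longrightarrow> k < card F \<Longrightarrow> \<exists>A B. A \<subseteq> F \<and> B \<subseteq> F \<and> A \<inter> B = {} \<and>
       (\<forall>X\<in>A. \<forall>Y\<in>B. \<not> touch G X Y) \<and> 3 * card A \<le> 2 * card F \<and> 3 * card B \<le> 2 * card F \<and>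
       12 * card (F - A - B) \<le> card F \<and>
       (\<forall>j. (4/3) ^ j \<le> real (card F) \<longrightarrow>
          2 * (real j + 1) * (real j + 2) * real (card (F - A - B)) \<le> \<epsilon> * real (card F))"
    and "shallow_family G D F" "real (card F) \<le> real k * (4/3) ^ j"
  shows "\<exists>\<A>. finite \<A> \<and> (\<forall>A\<in>\<A>. A \<subseteq> F \<and> card A \<le> k) \<and>
     (\<forall>X\<in>F. \<forall>Y\<in>F. touch G X Y \<longrightarrow> (\<exists>A\<in>\<A>. X \<in> A \<and> Y \<in> A)) \<and>
     real (\<Sum>A\<in>\<A>. card A) \<le> (1 + \<epsilon> * (1 - 1 / (real j + 1))) * real (card F)"
  using assms(5,6)
proof (induction j arbitrary: F)
  case 0
  \<comment> \<open>At level 0 \<open>F\<close> has at most \<open>k\<close> members and is a single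
    piece; the factor is 1.\<close>
  then show ?case by (intro exI[of _ "{F}"]) auto
next
  case (Suc j)
  let ?g = "\<lambda>j. 1 + \<epsilon> * (1 - 1 / (real j + 1))"
  have gmono: "?g j \<le> ?g (Suc j)"
    using \<open>0 < \<epsilon>\<close> by (simp add: frac_le mult_left_mono)
  show ?case
  proof (cases "real (card F) \<le> real k * (4/3) ^ j")
    case True
    then obtain \<A> where "finite \<A>" "\<forall>A\<in>\<A>. A \<subseteq> F \<and> card A \<le> k"
      "\<forall>X\<in>F. \<forall>Y\<in>F. touch G X Y \<longrightarrow> (\<exists>A\<in>\<A>. X \<in> A \<and> Y \<in> A)"
      "real (\<Sum>A\<in>\<A>. card A) \<le> ?g j * real (card F)"
      using Suc.IH[OF Suc.prems(1)] by blast
    moreover from this(4) have "real (\<Sum>A\<in>\<A>. card A) \<le> ?g (Suc j) * real (card F)"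
      using mult_right_mono[OF gmono, of "real (card F)"] by linarith
    ultimately show ?thesis by blast
  next
    case False
    have "real k * 1 \<le> real k * (4/3) ^ j" by (intro mult_left_mono) auto
    moreover have "1 * (4/3) ^ j \<le> real k * (4/3) ^ j" using \<open>k > 0\<close> by (intro mult_right_mono) auto
    \<comment> \<open>Beyond the bound of level \<open>j\<close>, \<open>F\<close> exceeds both
      \<open>k\<close> and (4/3)^j: the first permits a separator, the second gives its size bound
      for this \<open>j\<close>.\<close>
    ultimately have big: "k < card F" "(4/3) ^ j \<le> real (card F)" using False by linarith+
    obtain A B where AB: "A \<subseteq> F" "B \<subseteq> F" "A \<inter> B = {}" "\<forall>X\<in>A. \<forall>Y\<in>B. \<not> touch G X Y"
      "3 * card A \<le> 2 * card F" "3 * card B \<le> 2 * card F" and S12: "12 * card (F - A - B) \<le> card F"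
      and S: "2 * (real j + 1) * (real j + 2) * real (card (F - A - B)) \<le> \<epsilon> * real (card F)"
      using sep[OF Suc.prems(1) big(1)] big(2) by blast
    let ?S = "F - A - B"
    have finF: "finite F" using Suc.prems by (simp add: shallow_family_def)
    then have fin: "finite A" "finite B" using AB finite_subset by blast+
    have cA: "card (F - B) = card A + card ?S"
    proof -
      have "F - B = A \<union> ?S" using AB by blast
      then have "card (F - B) = card (A \<union> ?S)" by (rule arg_cong)
      also have "\<dots> = card A + card ?S" using fin finF by (intro card_Un_disjoint) auto
      finally show ?thesis .
    qed
    have cB: "card (F - A) = card B + card ?S"
    proof -
      have "F - A = B \<union> ?S" using AB by blast
      then have "card (F - A) = card (B \<union> ?S)" by (rule arg_cong)
      also have "\<dots> = card B + card ?S" using fin finF by (intro card_Un_disjoint) auto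
      finally show ?thesis .
    qed
    have cF: "card F = card A + card B + card ?S"
    proof -
      have "card F = card (F - A) + card A"
        using AB finF fin by (simp add: card_Diff_subset card_mono)
      then show ?thesis using cB by simp
    qed
    \<comment> \<open>One side has at most 2/3 of \<open>F\<close> and the separator at most 1/12,
      together 3/4, so both subfamilies drop to level \<open>j\<close>.\<close>
    have small: "real c \<le> real k * (4/3) ^ j" if "4 * c \<le> 3 * card F" for c
    proof -
      have "4 * real c \<le> 3 * real (card F)" using that by linarith
      then show ?thesis using Suc.prems(2) by simp
    qed
    have small': "real (card (F - B)) \<le> real k * (4/3) ^ j" "real (card (F - A)) \<le> real k * (4/3) ^ j"
      using cA cB AB(5,6) S12 by (intro small; linarith)+
    obtain \<A> where
      \<A>: "finite \<A>" "\<forall>X\<in>\<A>. X \<subseteq> F - B \<and> card X \<le> k"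
      "\<forall>X\<in>F - B. \<forall>Y\<in>F - B. touch G X Y \<longrightarrow> (\<exists>A\<in>\<A>. X \<in> A \<and> Y \<in> A)"
      "real (\<Sum>A\<in>\<A>. card A) \<le> ?g j * real (card (F - B))"
      using Suc.IH[OF shallow_family_subset[OF Suc.prems(1)] small'(1)] by blast
    obtain \<B> where
      \<B>: "finite \<B>" "\<forall>X\<in>\<B>. X \<subseteq> F - A \<and> card X \<le> k"
      "\<forall>X\<in>F - A. \<forall>Y\<in>F - A. touch G X Y \<longrightarrow> (\<exists>A\<in>\<B>. X \<in> A \<and> Y \<in> A)"
      "real (\<Sum>A\<in>\<B>. card A) \<le> ?g j * real (card (F - A))"
      using Suc.IH[OF shallow_family_subset[OF Suc.prems(1)] small'(2)] by blast
    \<comment> \<open>The separator is kept on both sides. As no member of \<open>A\<close> touches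
      one of \<open>B\<close>, a touching pair lies wholly in \<open>F - B\<close> or in
      \<open>F - A\<close>.\<close>
    have "\<exists>Z\<in>\<A> \<union> \<B>. X \<in> Z \<and> Y \<in> Z" if "X \<in> F" "Y \<in> F" "touch G X Y" for X Y
    proof -
      have "touch G Y X" using that(3) touch_sym[of G X Y] by simp
      then have "X \<notin> A \<or> Y \<notin> B" "Y \<notin> A \<or> X \<notin> B" "X \<notin> A \<or> X \<notin> B" "Y \<notin> A \<or> Y \<notin> B"
        using AB(3,4) that(3) by blast+
      then have "X \<in> F - B \<and> Y \<in> F - B \<or> X \<in> F - A \<and> Y \<in> F - A"
        using that(1,2) by (simp only: Diff_iff simp_thms) argo
      then show ?thesis
      proof
        assume "X \<in> F - B \<and> Y \<in> F - B"
        then show ?thesis using \<A>(3) that(3) by blast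
      next
        assume "X \<in> F - A \<and> Y \<in> F - A"
        then show ?thesis using \<B>(3) that(3) by blast
      qed
    qed
    moreover have "real (\<Sum>A\<in>\<A> \<union> \<B>. card A) \<le> ?g (Suc j) * real (card F)"
    proof -
      have "(\<Sum>A\<in>\<A> \<union> \<B>. card A) \<le> (\<Sum>A\<in>\<A>. card A) + (\<Sum>A\<in>\<B>. card A)"
        using \<A>(1) \<B>(1) by (simp add: sum_Un_nat)
      then have "real (\<Sum>A\<in>\<A> \<union> \<B>. card A) \<le> ?g j * real (card (F - B)) + ?g j * real (card (F - A))"
        using \<A>(4) \<B>(4) by linarith
      also have "\<dots> = ?g j * real (card F) + ?g j * real (card ?S)"
        unfolding cA cB cF by (simp add: algebra_simps)
      \<comment> \<open>The separator is counted on both sides; the extra copy is scaled by a factor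
        of at most 1 + \<epsilon> \<le> 2.\<close>
      also have "?g j * real (card ?S) \<le> 2 * real (card ?S)"
        using assms(1,2) by (intro mult_right_mono) (auto intro: mult_le_one)
      also have "2 * real (card ?S) \<le> \<epsilon> * real (card F) / ((real j + 1) * (real j + 2))"
        using S by (subst pos_le_divide_eq) (simp_all only: mult_ac, simp)
      also have "?g j * real (card F) + \<epsilon> * real (card F) / ((real j + 1) * (real j + 2))
          = ?g (Suc j) * real (card F)"
      proof -
        have "1 / (real j + 1) - 1 / (real (Suc j) + 1) = 1 / ((real j + 1) * (real j + 2))"
          by (simp add: field_simps)
        then have "?g (Suc j) = ?g j + \<epsilon> * (1 / ((real j + 1) * (real j + 2)))"
          by (simp add: algebra_simps)
        then show ?thesis by (simp add: algebra_simps)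
      qed
      finally show ?thesis by simp
    qed
    moreover have "\<forall>Z\<in>\<A> \<union> \<B>. Z \<subseteq> F \<and> card Z \<le> k" using \<A>(2) \<B>(2) by blast
    moreover have "finite (\<A> \<union> \<B>)" using \<A>(1) \<B>(1) by simp
    ultimately show ?thesis
      by (intro exI[of _ "\<A> \<union> \<B>"] conjI) blast+
  qed
qed

section \<open>Polylogarithmic growth and the choice of parameters\<close>

definition polylog :: "(nat \<Rightarrow> real) \<Rightarrow> bool" where
  "polylog f \<longleftrightarrow> (\<exists>e C. 0 \<le> C \<and> (\<forall>n\<ge>3. \<bar>f n\<bar> \<le> C * ln (real n) ^ e))"

text \<open>Since e \<le> 3, the threshold 3 in \<open>polylog\<close> makes powers of ln n
  non-decreasing in the exponent, so bounds with different exponents can be combined.\<close>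

lemma ln_ge_1: "1 \<le> ln (real n)" if "n \<ge> 3"
  using ln_le_cancel_iff[of "exp 1" "real n"] exp_le that by simp

lemma polylogI: "0 \<le> C \<Longrightarrow> (\<And>n. n \<ge> 3 \<Longrightarrow> \<bar>f n\<bar> \<le> C * ln (real n) ^ e) \<Longrightarrow> polylog f"
  unfolding polylog_def by blast

lemma polylog_bounded:
  assumes "polylog g" "\<And>n. n \<ge> 3 \<Longrightarrow> \<bar>f n\<bar> \<le> \<bar>g n\<bar>"
  shows "polylog f"
  using assms unfolding polylog_def by (meson order_trans)

lemma polylog_const: "polylog (\<lambda>_. c)"
  by (rule polylogI[of "\<bar>c\<bar>" _ 0]) auto

lemma polylog_ln: "polylog (\<lambda>n. ln (real n))"
  by (rule polylogI[of 1 _ 1]) auto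

lemma polylog_add:
  assumes "polylog f" "polylog g"
  shows "polylog (\<lambda>n. f n + g n)"
proof -
  obtain a A where f: "0 \<le> A" "\<And>n. n \<ge> 3 \<Longrightarrow> \<bar>f n\<bar> \<le> A * ln (real n) ^ a"
    using assms(1) by (auto simp: polylog_def)
  obtain b B where g: "0 \<le> B" "\<And>n. n \<ge> 3 \<Longrightarrow> \<bar>g n\<bar> \<le> B * ln (real n) ^ b"
    using assms(2) by (auto simp: polylog_def)
  have "\<bar>f n + g n\<bar> \<le> (A + B) * ln (real n) ^ (a + b)" if n: "n \<ge> 3" for n
  proof -
    have "ln (real n) ^ a \<le> ln (real n) ^ (a + b)" "ln (real n) ^ b \<le> ln (real n) ^ (a + b)"
      using ln_ge_1[OF n] by (auto intro!: power_increasing)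
    then have "A * ln (real n) ^ a \<le> A * ln (real n) ^ (a + b)"
        "B * ln (real n) ^ b \<le> B * ln (real n) ^ (a + b)"
      using f(1) g(1) by (auto intro: mult_left_mono)
    then show ?thesis using f(2)[OF n] g(2)[OF n] unfolding distrib_right by linarith
  qed
  then show ?thesis using f(1) g(1) by (intro polylogI[of "A + B"]) auto
qed

lemma polylog_mult:
  assumes "polylog f" "polylog g"
  shows "polylog (\<lambda>n. f n * g n)"
proof -
  obtain a A where f: "0 \<le> A" "\<And>n. n \<ge> 3 \<Longrightarrow> \<bar>f n\<bar> \<le> A * ln (real n) ^ a"
    using assms(1) by (auto simp: polylog_def)
  obtain b B where g: "0 \<le> B" "\<And>n. n \<ge> 3 \<Longrightarrow> \<bar>g n\<bar> \<le> B * ln (real n) ^ b"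
    using assms(2) by (auto simp: polylog_def)
  have "\<bar>f n * g n\<bar> \<le> (A * B) * ln (real n) ^ (a + b)" if n: "n \<ge> 3" for n
    using mult_mono[OF f(2)[OF n] g(2)[OF n]] f(1) ln_ge_1[OF n]
    by (simp add: abs_mult power_add mult_ac)
  then show ?thesis using f(1) g(1) by (intro polylogI[of "A * B"]) auto
qed

lemma polylog_power: "polylog f \<Longrightarrow> polylog (\<lambda>n. f n ^ k)"
  by (induction k) (auto intro: polylog_const polylog_mult)

lemma polylog_nat_ceiling:
  assumes "polylog f"
  shows "polylog (\<lambda>n. real (nat \<lceil>f n\<rceil>))"
proof (rule polylog_bounded[of "\<lambda>n. \<bar>f n\<bar> + 1"])
  show "polylog (\<lambda>n. \<bar>f n\<bar> + 1)"
    using assms polylog_const[of 1] by (intro polylog_add) (auto simp: polylog_def)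
  show "\<bar>real (nat \<lceil>f n\<rceil>)\<bar> \<le> \<bar>\<bar>f n\<bar> + 1\<bar>" for n
    by (cases "\<lceil>f n\<rceil> \<ge> 0") (simp_all, linarith)
qed

lemma polylog_poly: "polylog f \<Longrightarrow> polylog (\<lambda>n. poly p (f n))"
  by (induction p) (auto intro: polylog_const polylog_add polylog_mult)

lemmas polylog_intros = polylog_const polylog_ln polylog_add polylog_mult polylog_power
  polylog_nat_ceiling polylog_poly

text \<open>With t = ln n the quotient is t^e / exp t, which tends to 0.\<close>

lemma polylog_le_linear:
  assumes "polylog f"
  shows "\<forall>\<^sub>F n in sequentially. f n \<le> real n"
proof -
  obtain e C where C: "0 \<le> C" "\<And>n. n \<ge> 3 \<Longrightarrow> \<bar>f n\<bar> \<le> C * ln (real n) ^ e"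
    using assms by (auto simp: polylog_def)
  have "((\<lambda>n. ln (real n) ^ e / exp (ln (real n))) \<longlongrightarrow> 0) sequentially"
    by (rule filterlim_compose[OF tendsto_power_div_exp_0])
       (rule filterlim_compose[OF ln_at_top filterlim_real_sequentially])
  then have "((\<lambda>n. C * (ln (real n) ^ e / exp (ln (real n)))) \<longlongrightarrow> 0) sequentially"
    by (rule tendsto_mult_right_zero)
  then have "\<forall>\<^sub>F n in sequentially. C * (ln (real n) ^ e / exp (ln (real n))) < 1"
    by (rule order_tendstoD) simp
  then show ?thesis
    using eventually_ge_at_top[of "3::nat"]
  proof eventually_elim
    case (elim n)
    then have "C * ln (real n) ^ e < real n" by (simp add: field_simps)
    then show ?case using C(2)[OF elim(2)] by simp
  qed
qed

text \<open>Chooses, for every large family size \<open>n\<close>, the parameters of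
  \<open>shallow_family_separator\<close>; \<open>S\<close> stands for the size of the separator.
  All parameters are polylogarithmic in \<open>n\<close>, so the members met by branch sets are
  eventually few compared with \<open>n\<close>, while \<open>l\<close> controls the carved
  boundaries.\<close>

lemma separator_parameters:
  fixes p :: "real poly" and \<epsilon> :: real
  assumes "0 < \<epsilon>" "\<epsilon> \<le> 1" "\<And>i::nat. 0 \<le> poly p (real i)"
  shows "\<exists>k>0. \<forall>n>k. \<exists>l q r h. l > 0 \<and> real n \<le> (1 + 1 / real l) ^ q \<and> r = (2 * q + 3) * (D + 1) \<and>
           2 * poly p (real r) + 1 \<le> real h \<and>
           (\<forall>S. l * S \<le> n + 2 * l * h * (h * (r + 1) + 1) \<longrightarrow> 12 * S \<le> n \<and>
             (\<forall>j. (4/3) ^ j \<le> real n \<longrightarrow> 2 * (real j + 1) * (real j + 2) * real S \<le> \<epsilon> * real n))"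
proof -
  \<comment> \<open>The logarithm of \<open>n\<close> to base 4/3, an upper bound for every level
    \<open>j\<close> with (4/3)^j \<le> n.\<close>
  define L where "L n = ln (real n) / ln (4/3)" for n :: nat
  \<comment> \<open>The aim is S \<le> n / \<mu>. The numerator dominates 2 (j + 1) (j + 2) for j
    \<le> L, and \<mu> \<ge> 12 yields 12 S \<le> n.\<close>
  define \<mu> where "\<mu> n = 12 * (L n + 2) ^ 2 / \<epsilon>" for n
  \<comment> \<open>The factor 2 reserves half of n / \<mu> for the carved boundaries; the other
    half is left for the members met by branch sets.\<close>
  define l where "l n = nat \<lceil>2 * \<mu> n\<rceil>" for n
  \<comment> \<open>As ln (1 + 1 / l) \<ge> 1 / (2 l) for l \<ge> 2, this exponent raises 1 + 1 / l
    to at least \<open>n\<close>.\<close>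
  define q where "q n = nat \<lceil>2 * real (l n) * ln (real n)\<rceil>" for n
  define r where "r n = (2 * q n + 3) * (D + 1)" for n
  define h where "h n = nat \<lceil>2 * poly p (real (r n)) + 1\<rceil>" for n
  have L: "polylog L"
    unfolding L_def divide_inverse by (intro polylog_intros)
  have \<mu>: "polylog \<mu>"
    unfolding \<mu>_def divide_inverse
    by (intro polylog_intros L)
  have l: "polylog (\<lambda>n. real (l n))" unfolding l_def by (intro polylog_intros \<mu>)
  have q: "polylog (\<lambda>n. real (q n))" unfolding q_def by (intro polylog_intros l)
  have r: "polylog (\<lambda>n. real (r n))"
    unfolding r_def of_nat_mult of_nat_add by (intro polylog_intros q)
  have h: "polylog (\<lambda>n. real (h n))" unfolding h_def by (intro polylog_intros r)
  have "polylog (\<lambda>n. 4 * real (h n) * (real (h n) * (real (r n) + 1) + 1) * \<mu> n)"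
    by (intro polylog_intros h r \<mu>)
  then obtain N where N: "\<And>n. n \<ge> N \<Longrightarrow> 4 * real (h n) * (real (h n) * (real (r n) + 1) + 1) * \<mu> n \<le> real n"
    using polylog_le_linear by (auto simp: eventually_sequentially)
  show ?thesis
  proof (rule exI[of _ "N + 3"], intro conjI allI impI)
    fix n assume "n > N + 3"
    then have n: "n \<ge> N" "n \<ge> 3" by auto
    have L0: "0 \<le> L n" using ln_ge_1[OF n(2)] by (simp add: L_def)
    then have sq: "4 \<le> (L n + 2) ^ 2" using power_mono[of 2 "L n + 2" 2] by simp
    then have \<mu>12: "12 \<le> \<mu> n" using assms(1,2) by (simp add: \<mu>_def field_simps)
    have ll: "2 * \<mu> n \<le> real (l n)" unfolding l_def by linarith
    then have lpos: "l n > 0" using \<mu>12 by linarith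
    have "real n \<le> (1 + 1 / real (l n)) ^ q n"
    proof -
      let ?x = "1 / real (l n)"
      have x: "0 \<le> ?x" "?x \<le> 1" using lpos by auto
      have "?x / 2 \<le> ?x - ?x\<^sup>2"  if "?x \<le> 1 / 2"
        using that x mult_left_mono[OF that, of ?x] by (simp add: power2_eq_square)
      moreover have "?x \<le> 1 / 2" using ll \<mu>12 lpos by (simp add: field_simps)
      ultimately have "?x / 2 \<le> ln (1 + ?x)"
        using ln_one_plus_pos_lower_bound[of ?x] x by linarith
      then have "real (q n) * (?x / 2) \<le> real (q n) * ln (1 + ?x)" by (rule mult_left_mono) simp
      moreover have "2 * real (l n) * ln (real n) \<le> real (q n)" unfolding q_def by linarith
      then have "ln (real n) \<le> real (q n) * (?x / 2)" using lpos by (simp add: field_simps)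
      ultimately have "ln (real n) \<le> real (q n) * ln (1 + ?x)" by linarith
      also have "\<dots> = ln ((1 + ?x) ^ q n)" using x by (simp add: ln_realpow)
      finally show ?thesis using n(2) x by (subst (asm) ln_le_cancel_iff) (auto simp: add_pos_nonneg)
    qed
    moreover have "2 * poly p (real (r n)) + 1 \<le> real (h n)" unfolding h_def by linarith
    moreover have "12 * S \<le> n \<and>
       (\<forall>j. (4/3) ^ j \<le> real n \<longrightarrow> 2 * (real j + 1) * (real j + 2) * real S \<le> \<epsilon> * real n)"
      if S: "l n * S \<le> n + 2 * l n * h n * (h n * (r n + 1) + 1)" for S
    proof -
      let ?H = "real (h n) * (real (h n) * (real (r n) + 1) + 1)"
      have "real (l n * S) \<le> real (n + 2 * l n * h n * (h n * (r n + 1) + 1))"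
        using S by (rule of_nat_mono)
      then have "real (l n) * real S \<le> real n + 2 * real (l n) * ?H"
        by (simp add: algebra_simps)
      then have "real S \<le> (real n + 2 * real (l n) * ?H) / real (l n)"
        using lpos by (simp add: pos_le_divide_eq mult.commute)
      also have "\<dots> = real n / real (l n) + 2 * ?H" using lpos by (simp add: add_divide_distrib)
      also have "real n / real (l n) \<le> real n / (2 * \<mu> n)"
        using ll \<mu>12 by (intro divide_left_mono) auto
      also have "2 * ?H \<le> real n / (2 * \<mu> n)"
        using N[OF n(1)] \<mu>12 by (simp add: pos_le_divide_eq mult_ac)
      finally have "real S \<le> real n / \<mu> n" using \<mu>12 by (simp add: field_simps)
      then have S\<mu>: "\<mu> n * real S \<le> real n" using \<mu>12 by (simp add: pos_le_divide_eq mult.commute)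
      have "12 * real S \<le> \<mu> n * real S" using \<mu>12 by (intro mult_right_mono) auto
      then have "12 * S \<le> n" using S\<mu> by linarith
      moreover have "2 * (real j + 1) * (real j + 2) * real S \<le> \<epsilon> * real n" if j: "(4/3) ^ j \<le> real n" for j
      proof -
        have "ln ((4/3) ^ j) \<le> ln (real n)" using j n(2) by simp
        then have "real j * ln (4/3) \<le> ln (real n)" by (simp add: ln_realpow)
        then have jL: "real j \<le> L n" by (simp add: L_def pos_le_divide_eq)
        have "(real j + 1) * (real j + 2) \<le> (L n + 2) * (L n + 2)"
          using jL L0 by (intro mult_mono) auto
        then have "2 * (real j + 1) * (real j + 2) \<le> 12 * (L n + 2) ^ 2"
          using sq unfolding power2_eq_square mult.assoc by linarith
        also have "\<dots> = \<epsilon> * \<mu> n" using assms(1) by (simp add: \<mu>_def)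
        finally have "2 * (real j + 1) * (real j + 2) * real S \<le> \<epsilon> * \<mu> n * real S"
          by (rule mult_right_mono) simp
        also have "\<dots> \<le> \<epsilon> * real n" using S\<mu> assms(1) by (simp add: mult.assoc)
        finally show ?thesis .
      qed
      ultimately show ?thesis by blast
    qed
    ultimately show "\<exists>l q r h. l > 0 \<and> real n \<le> (1 + 1 / real l) ^ q \<and> r = (2 * q + 3) * (D + 1) \<and>
           2 * poly p (real r) + 1 \<le> real h \<and>
           (\<forall>S. l * S \<le> n + 2 * l * h * (h * (r + 1) + 1) \<longrightarrow> 12 * S \<le> n \<and>
             (\<forall>j. (4/3) ^ j \<le> real n \<longrightarrow> 2 * (real j + 1) * (real j + 2) * real S \<le> \<epsilon> * real n))"
      using lpos r_def by blast
  qed simp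
qed

text \<open>Expansion enters only through h \<ge> 2 p(r) + 1, which caps the number of branch sets;
  hence one \<open>k\<close> serves all graphs with the same bound \<open>p\<close>.\<close>

lemma polynomial_expansion_cover:
  fixes p :: "real poly" and \<epsilon> :: real
  assumes "0 < \<epsilon>" "\<epsilon> \<le> 1" "\<And>i::nat. 0 \<le> poly p (real i)"
  obtains k where "\<And>(G :: 'a graph) F. simple_graph G \<Longrightarrow>
      expansion_bounded_by G (\<lambda>r. poly p (real r)) \<Longrightarrow> shallow_family G D F \<Longrightarrow>
      \<exists>\<A>. finite \<A> \<and> (\<forall>A\<in>\<A>. A \<subseteq> F \<and> card A \<le> k) \<and>
       (\<forall>X\<in>F. \<forall>Y\<in>F. touch G X Y \<longrightarrow> (\<exists>A\<in>\<A>. X \<in> A \<and> Y \<in> A)) \<and>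
       real (\<Sum>A\<in>\<A>. card A) \<le> (1 + \<epsilon>) * real (card F)"
proof -
  obtain k where "k > 0" and k: "\<And>n. n > k \<Longrightarrow> \<exists>l q r h. l > 0 \<and> real n \<le> (1 + 1 / real l) ^ q \<and>
           r = (2 * q + 3) * (D + 1) \<and> 2 * poly p (real r) + 1 \<le> real h \<and>
           (\<forall>S. l * S \<le> n + 2 * l * h * (h * (r + 1) + 1) \<longrightarrow> 12 * S \<le> n \<and>
             (\<forall>j. (4/3) ^ j \<le> real n \<longrightarrow> 2 * (real j + 1) * (real j + 2) * real S \<le> \<epsilon> * real n))"
    using separator_parameters[OF assms, of D] by blast
  show thesis
  proof (rule that)
    fix G :: "'a graph" and F
    assume G: "simple_graph G" "expansion_bounded_by G (\<lambda>r. poly p (real r))" "shallow_family G D F"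
    have sep: "\<exists>A B. A \<subseteq> F \<and> B \<subseteq> F \<and> A \<inter> B = {} \<and>
       (\<forall>X\<in>A. \<forall>Y\<in>B. \<not> touch G X Y) \<and> 3 * card A \<le> 2 * card F \<and> 3 * card B \<le> 2 * card F \<and>
       12 * card (F - A - B) \<le> card F \<and>
       (\<forall>j. (4/3) ^ j \<le> real (card F) \<longrightarrow>
          2 * (real j + 1) * (real j + 2) * real (card (F - A - B)) \<le> \<epsilon> * real (card F))"
      if F: "shallow_family G D F" "k < card F" for F
    proof -
      obtain l q r h where lq: "l > 0" "real (card F) \<le> (1 + 1 / real l) ^ q" "r = (2 * q + 3) * (D + 1)"
          "2 * poly p (real r) + 1 \<le> real h" and
        S: "\<And>S. l * S \<le> card F + 2 * l * h * (h * (r + 1) + 1) \<Longrightarrow> 12 * S \<le> card F \<and>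
             (\<forall>j. (4/3) ^ j \<le> real (card F) \<longrightarrow>
                2 * (real j + 1) * (real j + 2) * real S \<le> \<epsilon> * real (card F))"
        using k[OF F(2)] by blast
      have "card M \<le> h" if "clique_model G r s M" for M s
        using clique_model_card_le[OF G(2) that assms(3)] lq(4) by linarith
      then have "\<forall>M s. clique_model G r s M \<longrightarrow> card M \<le> h" by blast
      from shallow_family_separator[OF G(1) F(1) lq(1) this lq(2,3)]
      obtain A B where AB: "A \<subseteq> F" "B \<subseteq> F" "A \<inter> B = {}" "\<forall>X\<in>A. \<forall>Y\<in>B. \<not> touch G X Y"
           "3 * card A \<le> 2 * card F" "3 * card B \<le> 2 * card F" and
           small: "l * card (F - A - B) \<le> card F + 2 * l * h * (h * (r + 1) + 1)" by metis
      from AB S[OF small] show ?thesis by (intro exI[of _ A] exI[of _ B]) simp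
    qed
    \<comment> \<open>Any sufficiently high level starts the recursion; \<open>k\<close> does not
      depend on it, because the factor stays below 1 + \<epsilon> on every level.\<close>
    obtain j where "real (card F) < (4/3) ^ j" using real_arch_pow[of "4/3" "real (card F)"] by auto
    moreover have "1 * (4/3) ^ j \<le> real k * (4/3) ^ j" using \<open>k > 0\<close> by (intro mult_right_mono) auto
    ultimately have "real (card F) \<le> real k * (4/3) ^ j" by linarith
    from shallow_family_cover[OF assms(1,2) \<open>k > 0\<close> sep G(3) this] obtain \<A> where
      \<A>: "finite \<A>" "\<forall>A\<in>\<A>. A \<subseteq> F \<and> card A \<le> k"
       "\<forall>X\<in>F. \<forall>Y\<in>F. touch G X Y \<longrightarrow> (\<exists>A\<in>\<A>. X \<in> A \<and> Y \<in> A)"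
       "real (\<Sum>A\<in>\<A>. card A) \<le> (1 + \<epsilon> * (1 - 1 / (real j + 1))) * real (card F)" by blast
    note \<A>(4)
    also have "(1 + \<epsilon> * (1 - 1 / (real j + 1))) * real (card F) \<le> (1 + \<epsilon>) * real (card F)"
      using assms(1) by (intro mult_right_mono) auto
    finally show "\<exists>\<A>. finite \<A> \<and> (\<forall>A\<in>\<A>. A \<subseteq> F \<and> card A \<le> k) \<and>
     (\<forall>X\<in>F. \<forall>Y\<in>F. touch G X Y \<longrightarrow> (\<exists>A\<in>\<A>. X \<in> A \<and> Y \<in> A)) \<and>
     real (\<Sum>A\<in>\<A>. card A) \<le> (1 + \<epsilon>) * real (card F)"
      using \<A>(1-3) by blast
  qed
qed

section \<open>Local search\<close>

lemma packing_separated: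
  assumes "packing ind \<pi> G P" "X \<in> P" "Y \<in> P" "X \<noteq> Y"
  shows "X \<inter> Y = {} \<and> (ind \<longrightarrow> (\<forall>x\<in>X. \<forall>y\<in>Y. {x, y} \<notin> edges G))"
  using assms by (simp add: packing_def)

lemma packing_member:
  assumes "packing ind \<pi> G P" "X \<in> P"
  shows "X \<subseteq> verts G" "\<pi> G X"
  using assms by (simp_all add: packing_def)

lemma packing_finite: "simple_graph G \<Longrightarrow> packing ind \<pi> G P \<Longrightarrow> finite P"
  by (rule finite_subset[of _ "Pow (verts G)"]) (auto simp: packing_def simple_graph_def)

text \<open>Members of one packing are disjoint, so a vertex lies in at most one member of
  \<open>P\<close> and one of \<open>Q\<close>.\<close>

lemma packing_shallow_family:
  assumes "simple_graph G" "is_property \<pi>" "packing ind \<pi> G P" "packing ind \<pi> G Q"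
    and D: "\<And>Z. \<pi> G Z \<Longrightarrow> \<forall>u\<in>Z. \<forall>v\<in>Z. dist_le (induced G Z) D u v"
  shows "shallow_family G D (P \<union> Q)"
proof -
  have fin: "finite P" "finite Q" using packing_finite assms by blast+
  have one: "card {X \<in> R. v \<in> X} \<le> 1" if "packing ind \<pi> G R" for R v
  proof -
    have "finite {X \<in> R. v \<in> X}" using packing_finite[OF assms(1) that] by simp
    moreover have "\<forall>X\<in>{X \<in> R. v \<in> X}. \<forall>Y\<in>{X \<in> R. v \<in> X}. X = Y"
    proof (intro ballI)
      fix X Y assume "X \<in> {X \<in> R. v \<in> X}" "Y \<in> {X \<in> R. v \<in> X}"
      then have "X \<in> R" "Y \<in> R" "X \<inter> Y \<noteq> {}" by auto
      then show "X = Y" using packing_separated[OF that] by metis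
    qed
    ultimately show ?thesis by (simp add: card_le_Suc0_iff_eq)
  qed
  have "card {X \<in> P \<union> Q. v \<in> X} \<le> 2" for v
  proof -
    have "{X \<in> P \<union> Q. v \<in> X} = {X \<in> P. v \<in> X} \<union> {X \<in> Q. v \<in> X}" by blast
    then show ?thesis
      using card_Un_le[of "{X \<in> P. v \<in> X}" "{X \<in> Q. v \<in> X}"] one[OF assms(3), of v] one[OF assms(4), of v]
      by simp
  qed
  moreover have "\<pi> G X" "X \<subseteq> verts G" if "X \<in> P \<union> Q" for X
    using that packing_member[OF assms(3), of X] packing_member[OF assms(4), of X] by blast+
  ultimately show ?thesis
    using fin D assms(2) unfolding shallow_family_def is_property_def by blast
qed

text \<open>For a piece \<open>A\<close> of the cover, the members of \<open>Q\<close> lying in no other piece can replace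
  \<open>P \<inter> A\<close>, since everything they touch lies in \<open>A\<close>.\<close>

lemma locally_optimal_card:
  assumes G: "simple_graph G" and PQ: "packing ind \<pi> G P" "packing ind \<pi> G Q"
    and opt: "\<not> (\<exists>P'. ls_step ind \<pi> G c P P')" and "k < c"
    and \<A>: "finite \<A>" "\<forall>A\<in>\<A>. A \<subseteq> P \<union> Q \<and> card A \<le> k"
      "\<forall>X\<in>P \<union> Q. \<forall>Y\<in>P \<union> Q. touch G X Y \<longrightarrow> (\<exists>A\<in>\<A>. X \<in> A \<and> Y \<in> A)"
    and ne: "{} \<notin> P \<union> Q"
  shows "card Q + 2 * card (P \<union> Q) \<le> card P + 2 * (\<Sum>A\<in>\<A>. card A)"
proof -
  have fin: "finite P" "finite Q" using packing_finite[OF G] PQ by blast+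
  let ?F = "P \<union> Q"
  \<comment> \<open>The number of pieces containing \<open>X\<close>. Its sum is the total size of
    the pieces, so the sum of \<open>deg X - 1\<close> is the redundancy of the cover.\<close>
  define deg where "deg X = card {A \<in> \<A>. X \<in> A}" for X
  have deg_sum: "(\<Sum>A\<in>\<A>. card (R \<inter> A)) = (\<Sum>X\<in>R. deg X)" if "finite R" for R
  proof -
    have "(\<Sum>A\<in>\<A>. card (R \<inter> A)) = (\<Sum>A\<in>\<A>. \<Sum>X\<in>R. if X \<in> A then 1 else 0)"
      using that by (simp add: sum.If_cases Int_def)
    also have "\<dots> = (\<Sum>X\<in>R. \<Sum>A\<in>\<A>. if X \<in> A then 1 else 0)" by (rule sum.swap)
    also have "\<dots> = (\<Sum>X\<in>R. deg X)"
      using \<A>(1) by (simp add: sum.If_cases deg_def Int_def)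
    finally show ?thesis .
  qed
  have deg_pos: "deg X \<ge> 1" if X: "X \<in> ?F" for X
  proof -
    \<comment> \<open>A non-empty set touches itself, so a cover of the touching pairs also covers
      every member.\<close>
    have "touch G X X" using X ne by (auto simp: touch_def)
    then obtain A where "A \<in> \<A>" "X \<in> A" using \<A>(3) X by blast
    then have "{A \<in> \<A>. X \<in> A} \<noteq> {}" by blast
    then show ?thesis using \<A>(1) by (simp add: deg_def Suc_le_eq card_gt_0_iff)
  qed
  define Q1 where "Q1 = {X \<in> Q. deg X = 1}"
  have Q1: "Q1 \<subseteq> Q" by (auto simp: Q1_def)
  have swap: "card (Q1 \<inter> A) \<le> card (P \<inter> A)" if A: "A \<in> \<A>" for A
  proof (rule ccontr)
    assume "\<not> ?thesis"
    then have gt: "card (P \<inter> A) < card (Q1 \<inter> A)" by simp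
    define P' where "P' = (P - A) \<union> (Q1 \<inter> A)"
    \<comment> \<open>\<open>A\<close> is the only piece containing \<open>Y\<close>, so a member
      touching \<open>Y\<close> shares that piece and lies in \<open>A\<close>.\<close>
    have untouched: "\<not> touch G X Y" if XY: "X \<in> P - A" "Y \<in> Q1 \<inter> A" for X Y
    proof
      assume "touch G X Y"
      moreover have "X \<in> P \<union> Q" "Y \<in> P \<union> Q" using XY Q1 by auto
      ultimately obtain A' where A': "A' \<in> \<A>" "X \<in> A'" "Y \<in> A'" using \<A>(3) by blast
      have "card {A \<in> \<A>. Y \<in> A} = 1" using XY by (simp add: Q1_def deg_def)
      then obtain B where B: "{A \<in> \<A>. Y \<in> A} = {B}" using card_1_singletonE by blast
      have "A \<in> {A \<in> \<A>. Y \<in> A}" "A' \<in> {A \<in> \<A>. Y \<in> A}" using A A' XY by auto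
      then have "A = A'" unfolding B by simp
      then show False using A'(2) XY(1) by simp
    qed
    have sep: "X \<inter> Y = {} \<and> (ind \<longrightarrow> (\<forall>x\<in>X. \<forall>y\<in>Y. {x, y} \<notin> edges G))"
      if XY: "X \<in> P'" "Y \<in> P'" "X \<noteq> Y" for X Y
    proof -
      consider "X \<in> P" "Y \<in> P" | "X \<in> Q" "Y \<in> Q" | "\<not> touch G X Y"
        using XY Q1 untouched[of X Y] untouched[of Y X] touch_sym[of G X Y] unfolding P'_def by blast
      then show ?thesis
      proof cases
        case 1
        then show ?thesis using packing_separated[OF PQ(1)] XY(3) by simp
      next
        case 2
        then show ?thesis using packing_separated[OF PQ(2)] XY(3) by simp
      next
        case 3
        then show ?thesis by (auto simp: touch_def)
      qed
    qed
    have "packing ind \<pi> G P'"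
    proof -
      have "X \<subseteq> verts G \<and> \<pi> G X" if "X \<in> P'" for X
        using that Q1 packing_member[OF PQ(1), of X] packing_member[OF PQ(2), of X]
        by (auto simp: P'_def)
      then show ?thesis using sep by (simp add: packing_def)
    qed
    moreover have "card P < card P'"
    proof -
      have "card P' = card (P - A) + card (Q1 \<inter> A)"
        unfolding P'_def using fin Q1 by (intro card_Un_disjoint) (auto intro: finite_subset)
      moreover have "card P = card (P - A) + card (P \<inter> A)"
        using fin by (metis card_Int_Diff add.commute)
      ultimately show ?thesis using gt by simp
    qed
    \<comment> \<open>Bounded pieces matter here: at most \<open>k\<close> members leave
      \<open>P\<close>, so the exchange is one that the search tries.\<close>
    moreover have "card (P \<inter> A) < c"
    proof -
      have "finite A" using \<A>(2) A fin by (meson finite_Un finite_subset)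
      then have "card (P \<inter> A) \<le> card A" by (intro card_mono) auto
      then show ?thesis using \<A>(2) A \<open>k < c\<close> by fastforce
    qed
    moreover have "P - (P \<inter> A) \<subseteq> P'" by (auto simp: P'_def)
    ultimately have "ls_step ind \<pi> G c P P'" unfolding ls_step_def by blast
    then show False using opt by blast
  qed
  \<comment> \<open>Summing the exchange inequality over all pieces counts each member of
    \<open>Q1\<close> once and each member of \<open>P\<close> with multiplicity
    \<open>deg\<close>.\<close>
  have "(\<Sum>X\<in>Q1. deg X) \<le> (\<Sum>X\<in>P. deg X)"
    using sum_mono[of \<A> "\<lambda>A. card (Q1 \<inter> A)" "\<lambda>A. card (P \<inter> A)"] swap
      deg_sum[of Q1] deg_sum[of P] fin Q1 finite_subset by metis
  then have 1: "card Q1 \<le> (\<Sum>X\<in>P. deg X)" by (simp add: Q1_def)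
  have deg1: "(\<Sum>X\<in>R. deg X) = card R + (\<Sum>X\<in>R. deg X - 1)" if "R \<subseteq> ?F" for R
  proof -
    have "(\<Sum>X\<in>R. deg X) = (\<Sum>X\<in>R. 1 + (deg X - 1))"
    proof (rule sum.cong[OF refl])
      fix X assume "X \<in> R"
      then show "deg X = 1 + (deg X - 1)" using deg_pos[of X] that by auto
    qed
    then show ?thesis by (simp only: sum.distrib card_eq_sum)
  qed
  have excess: "(\<Sum>X\<in>R. deg X - 1) \<le> (\<Sum>X\<in>?F. deg X - 1)" if "R \<subseteq> ?F" for R
    using that fin by (intro sum_mono2) auto
  \<comment> \<open>Members of \<open>Q\<close> outside \<open>Q1\<close> lie in at least two
    pieces, so each contributes at least 1 to the excess.\<close>
  have "card Q \<le> card Q1 + (\<Sum>X\<in>Q. deg X - 1)"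
  proof -
    have "card Q = card Q1 + card (Q - Q1)" using Q1 fin
      by (simp add: card_Diff_subset card_mono finite_subset)
    also have "card (Q - Q1) = (\<Sum>X\<in>Q - Q1. 1)" by simp
    also have "\<dots> \<le> (\<Sum>X\<in>Q - Q1. deg X - 1)"
    proof (rule sum_mono)
      fix X assume "X \<in> Q - Q1"
      then show "1 \<le> deg X - 1" using deg_pos[of X] by (auto simp: Q1_def)
    qed
    also have "\<dots> \<le> (\<Sum>X\<in>Q. deg X - 1)" using fin by (intro sum_mono2) auto
    finally show ?thesis by simp
  qed
  also have "\<dots> \<le> (\<Sum>X\<in>P. deg X) + (\<Sum>X\<in>?F. deg X - 1)"
    using 1 excess[of Q] by auto
  also have "(\<Sum>X\<in>P. deg X) \<le> card P + (\<Sum>X\<in>?F. deg X - 1)"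
    using deg1[of P] excess[of P] by auto
  \<comment> \<open>The total excess is paid twice: once for \<open>Q - Q1\<close>, once for the
    multiplicities in \<open>P\<close>.\<close>
  finally have "card Q \<le> card P + 2 * (\<Sum>X\<in>?F. deg X - 1)" by simp
  moreover have "(\<Sum>A\<in>\<A>. card A) = (\<Sum>X\<in>?F. deg X)"
  proof -
    have "(\<Sum>A\<in>\<A>. card A) = (\<Sum>A\<in>\<A>. card (?F \<inter> A))"
      using \<A>(2) by (intro sum.cong) (auto simp: Int_absorb1)
    then show ?thesis using deg_sum[of ?F] fin by simp
  qed
  ultimately show ?thesis using deg1[of ?F] by simp
qed

text \<open>\<open>Max\<close> ranges over a finite non-empty set: packings are sets of subsets of a
  finite vertex set, and the empty packing exists.\<close>

lemma alpha_attained: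
  assumes "simple_graph G"
  obtains Q where "packing ind \<pi> G Q" "card Q = alpha ind \<pi> G"
    "\<And>P. packing ind \<pi> G P \<Longrightarrow> card P \<le> alpha ind \<pi> G"
proof -
  let ?S = "{card P | P. packing ind \<pi> G P}"
  have "{P. packing ind \<pi> G P} \<subseteq> Pow (Pow (verts G))" by (auto simp: packing_def)
  moreover have "finite (Pow (Pow (verts G)))" using assms by (simp add: simple_graph_def)
  ultimately have "finite (card ` {P. packing ind \<pi> G P})" by (intro finite_imageI) (rule finite_subset)
  then have fin: "finite ?S" by (simp add: setcompr_eq_image)
  have "packing ind \<pi> G {}" by (simp add: packing_def)
  then have "?S \<noteq> {}" by blast
  then have "Max ?S \<in> ?S" using fin by (rule Max_in[rotated])
  then obtain Q where "packing ind \<pi> G Q" "card Q = alpha ind \<pi> G" by (auto simp: alpha_def)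
  moreover have "card P \<le> alpha ind \<pi> G" if "packing ind \<pi> G P" for P
    unfolding alpha_def using that fin by (intro Max_ge) auto
  ultimately show ?thesis using that by blast
qed

lemma ls_results_packing:
  assumes "P \<in> ls_results ind \<pi> G c"
  shows "packing ind \<pi> G P"
proof -
  have "(ls_step ind \<pi> G c)\<^sup>*\<^sup>* {} P" using assms by (simp add: ls_results_def)
  then show ?thesis by cases (auto simp: ls_step_def packing_def)
qed

theorem theorem2:
  fixes \<G> :: "'a graph set"
    and \<pi> :: "'a graph \<Rightarrow> 'a set \<Rightarrow> bool"
    and \<epsilon> :: real
  assumes "\<forall>G\<in>\<G>. simple_graph G"
    and "polynomial_expansion \<G>"
    and "is_property \<pi>"
    and "finite_diameter \<pi>"
    and "\<epsilon> > 0"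
  shows "\<exists>c::nat. c > 0 \<and>
    (\<forall>G\<in>\<G>.
       (\<forall>P\<in>ls_results False \<pi> G c. (1 - \<epsilon>) * real (alpha_pi \<pi> G) \<le> real (card P)) \<and>
       (\<forall>P\<in>ls_results True \<pi> G c. (1 - \<epsilon>) * real (alpha'_pi \<pi> G) \<le> real (card P)))"
proof -
  obtain p :: "real poly" where p: "\<And>i::nat. 0 \<le> poly p (real i)"
    "\<And>G. G \<in> \<G> \<Longrightarrow> expansion_bounded_by G (\<lambda>r. poly p (real r))"
    using assms(2) by (auto simp: polynomial_expansion_def)
  obtain D where D: "\<And>G Z. \<pi> G Z \<Longrightarrow> \<forall>u\<in>Z. \<forall>v\<in>Z. dist_le (induced G Z) D u v"
    using assms(4) unfolding finite_diameter_def by blast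
  \<comment> \<open>As |P| \<le> |Q|, the loss 2 \<delta> |P \<union> Q| is at most 4 \<delta> |Q|
    \<le> \<epsilon> |Q|; the minimum with 1 keeps \<delta> \<le> 1.\<close>
  define \<delta> where "\<delta> = min \<epsilon> 1 / 4"
  have \<delta>: "0 < \<delta>" "\<delta> \<le> 1" "4 * \<delta> \<le> \<epsilon>" using assms(5) by (auto simp: \<delta>_def)
  obtain k where k: "\<And>(G :: 'a graph) F. simple_graph G \<Longrightarrow>
      expansion_bounded_by G (\<lambda>r. poly p (real r)) \<Longrightarrow> shallow_family G D F \<Longrightarrow>
      \<exists>\<A>. finite \<A> \<and> (\<forall>A\<in>\<A>. A \<subseteq> F \<and> card A \<le> k) \<and>
       (\<forall>X\<in>F. \<forall>Y\<in>F. touch G X Y \<longrightarrow> (\<exists>A\<in>\<A>. X \<in> A \<and> Y \<in> A)) \<and>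
       real (\<Sum>A\<in>\<A>. card A) \<le> (1 + \<delta>) * real (card F)"
  proof (rule polynomial_expansion_cover[where D = D, OF \<delta>(1,2) p(1)])
  qed (rule that)
  \<comment> \<open>The search removes fewer than \<open>c\<close> sets, so \<open>c = k + 1\<close>
    admits every piece of up to \<open>k\<close> members.\<close>
  have main: "(1 - \<epsilon>) * real (alpha ind \<pi> G) \<le> real (card P)"
    if G: "G \<in> \<G>" and P: "P \<in> ls_results ind \<pi> G (k + 1)" for G P ind
  proof -
    have sG: "simple_graph G" using assms(1) G by blast
    have pP: "packing ind \<pi> G P" using P by (rule ls_results_packing)
    obtain Q where Q: "packing ind \<pi> G Q" "card Q = alpha ind \<pi> G"
      "\<And>P. packing ind \<pi> G P \<Longrightarrow> card P \<le> alpha ind \<pi> G"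
      using alpha_attained[OF sG] by blast
    have fam: "shallow_family G D (P \<union> Q)"
      using packing_shallow_family[OF sG assms(3) pP Q(1) D] .
    obtain \<A> where \<A>: "finite \<A>" "\<forall>A\<in>\<A>. A \<subseteq> P \<union> Q \<and> card A \<le> k"
      "\<forall>X\<in>P \<union> Q. \<forall>Y\<in>P \<union> Q. touch G X Y \<longrightarrow> (\<exists>A\<in>\<A>. X \<in> A \<and> Y \<in> A)"
      "real (\<Sum>A\<in>\<A>. card A) \<le> (1 + \<delta>) * real (card (P \<union> Q))"
      using k[OF sG p(2)[OF G] fam] by blast
    have "card Q + 2 * card (P \<union> Q) \<le> card P + 2 * (\<Sum>A\<in>\<A>. card A)"
    proof (rule locally_optimal_card[OF sG pP Q(1) _ _ \<A>(1-3)])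
      show "\<not> (\<exists>P'. ls_step ind \<pi> G (k + 1) P P')" using P by (simp add: ls_results_def)
      show "{} \<notin> P \<union> Q" using fam by (auto simp: shallow_family_def)
    qed simp
    then have "real (card Q + 2 * card (P \<union> Q)) \<le> real (card P + 2 * (\<Sum>A\<in>\<A>. card A))"
      by (rule of_nat_mono)
    then have "real (card Q) + 2 * real (card (P \<union> Q)) \<le> real (card P) + 2 * real (\<Sum>A\<in>\<A>. card A)"
      by (simp only: of_nat_add of_nat_mult of_nat_numeral)
    then have "real (card Q) \<le> real (card P) + 2 * \<delta> * real (card (P \<union> Q))"
      using \<A>(4) by (simp add: algebra_simps)
    also have "card (P \<union> Q) \<le> 2 * card Q"
      using card_Un_le[of P Q] Q(3)[OF pP] Q(2) by simp
    then have "2 * \<delta> * real (card (P \<union> Q)) \<le> 2 * \<delta> * real (2 * card Q)"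
      using \<delta>(1) by (intro mult_left_mono of_nat_mono) auto
    also have "2 * \<delta> * real (2 * card Q) \<le> \<epsilon> * real (card Q)"
      using mult_right_mono[OF \<delta>(3), of "real (card Q)"] by simp
    finally show ?thesis using Q(2) by (simp add: algebra_simps)
  qed
  then show ?thesis by (intro exI[of _ "k + 1"]) auto
qed

end
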